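(* Assume all hypotheses of the following setting hold: $L>0$, $a,b,c>0$, $p\in L^1[0,L]$; $M,N>0$ with $N\le\frac{4M}{L^3}\sigma(\sqrt M L)$; $\alpha,\beta$ are a lower and an upper solution of (P) with $0\le\alpha\le\beta$ and $0\ge\alpha''\ge\beta''$ on $[0,L]$, $a+b\int_0^L\beta\le M$ and $c-b\min_{[0,L]}\beta''\le N$. Assume in addition $$a+b\int_0^L\alpha(x)dx+\frac{L^3}{4}c>\frac{L^3N}{4}+M-\frac{4}{L^2}.$$ Then (P) has a unique solution $\widetilde y$ in $[\alpha,\beta]:=\{u\in C^2[0,L]:\alpha\le u\le\beta,\ \alpha''\ge u''\ge\beta''\}$, the sequences $(\alpha_n)$ (started at $\alpha$) and $(\beta_n)$ (started at $\beta$) converge uniformly to $\widetilde y$, and for every initial function $y_0\in[\alpha,\beta]$ the sequence $(y_n)$ produced by the iteration converges uniformly to $\widetilde y$.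
   Context: (P) denotes the problem $w''''-(a+b\int_0^L w)w''+c\int_0^L w=p$ a.e. in $(0,L)$, $w(0)=w(L)=w''(0)=w''(L)=0$, with solutions in $W^{4,1}[0,L]$. $\sigma(t):=\dfrac{3t^3}{6t\cosh t+6t-12\sinh t-t^3}$ for $t>0$. A lower solution of (P) is $\alpha\in W^{4,1}[0,L]$ with $\alpha''''-(a+b\int_0^L\alpha)\alpha''+c\int_0^L\alpha\le p$ a.e. and $\alpha(0)=\alpha(L)=\alpha''(0)=\alpha''(L)=0$; an upper solution has the reversed inequality. The iteration: $y_n\in W^{4,1}[0,L]$ is the unique solution of $y_n''''-My_n''+N\int_0^L y_n=p+(a+b\int_0^L y_{n-1})y_{n-1}''-c\int_0^L y_{n-1}-My_{n-1}''+N\int_0^L y_{n-1}$ with $y_n(0)=y_n(L)=y_n''(0)=y_n''(L)=0$, $n\ge1$. *)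

theory Defs
  imports "HOL-Analysis.Analysis"
begin

definition der :: "real \<Rightarrow> (real \<Rightarrow> real) \<Rightarrow> (real \<Rightarrow> real)" where
  "der L f = (\<lambda>x. SOME D. (f has_real_derivative D) (at x within {0..L}))"

abbreviation D2 :: "real \<Rightarrow> (real \<Rightarrow> real) \<Rightarrow> (real \<Rightarrow> real)" where
  "D2 L w \<equiv> (der L ^^ 2) w"

abbreviation D4 :: "real \<Rightarrow> (real \<Rightarrow> real) \<Rightarrow> (real \<Rightarrow> real)" where
  "D4 L w \<equiv> (der L ^^ 4) w"

text \<open>W^{4,1}[0,L]: w, w', w'' differentiable on [0,L] and w''' absolutely
  continuous (indefinite integral of an L^1 function).\<close>
definition W41 :: "real \<Rightarrow> (real \<Rightarrow> real) \<Rightarrow> bool" where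
  "W41 L w \<longleftrightarrow>
     (\<forall>k<3. \<forall>x\<in>{0..L}. ((der L ^^ k) w) differentiable (at x within {0..L})) \<and>
     (\<exists>g. g absolutely_integrable_on {0..L} \<and>
          (\<forall>x\<in>{0..L}. (der L ^^ 3) w x = (der L ^^ 3) w 0 + integral {0..x} g))"

definition C2 :: "real \<Rightarrow> (real \<Rightarrow> real) \<Rightarrow> bool" where
  "C2 L u \<longleftrightarrow>
     (\<forall>k<2. \<forall>x\<in>{0..L}. ((der L ^^ k) u) differentiable (at x within {0..L})) \<and>
     continuous_on {0..L} (D2 L u)"

definition ae_on :: "real \<Rightarrow> (real \<Rightarrow> bool) \<Rightarrow> bool" where
  "ae_on L P \<longleftrightarrow> (\<exists>S. negligible S \<and> (\<forall>x\<in>{0..L} - S. P x))"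

definition bc :: "real \<Rightarrow> (real \<Rightarrow> real) \<Rightarrow> bool" where
  "bc L w \<longleftrightarrow> w 0 = 0 \<and> w L = 0 \<and> D2 L w 0 = 0 \<and> D2 L w L = 0"

definition Pop :: "real \<Rightarrow> real \<Rightarrow> real \<Rightarrow> real \<Rightarrow> (real \<Rightarrow> real) \<Rightarrow> real \<Rightarrow> real" where
  "Pop L a b c w x = D4 L w x - (a + b * integral {0..L} w) * D2 L w x + c * integral {0..L} w"

definition is_sol :: "real \<Rightarrow> real \<Rightarrow> real \<Rightarrow> real \<Rightarrow> (real \<Rightarrow> real) \<Rightarrow> (real \<Rightarrow> real) \<Rightarrow> bool" where
  "is_sol L a b c p w \<longleftrightarrow> W41 L w \<and> bc L w \<and> ae_on L (\<lambda>x. Pop L a b c w x = p x)"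

definition is_lower :: "real \<Rightarrow> real \<Rightarrow> real \<Rightarrow> real \<Rightarrow> (real \<Rightarrow> real) \<Rightarrow> (real \<Rightarrow> real) \<Rightarrow> bool" where
  "is_lower L a b c p w \<longleftrightarrow> W41 L w \<and> bc L w \<and> ae_on L (\<lambda>x. Pop L a b c w x \<le> p x)"

definition is_upper :: "real \<Rightarrow> real \<Rightarrow> real \<Rightarrow> real \<Rightarrow> (real \<Rightarrow> real) \<Rightarrow> (real \<Rightarrow> real) \<Rightarrow> bool" where
  "is_upper L a b c p w \<longleftrightarrow> W41 L w \<and> bc L w \<and> ae_on L (\<lambda>x. Pop L a b c w x \<ge> p x)"

definition sigma :: "real \<Rightarrow> real" where
  "sigma t = 3 * t ^ 3 / (6 * t * cosh t + 6 * t - 12 * sinh t - t ^ 3)"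

definition ord_int :: "real \<Rightarrow> (real \<Rightarrow> real) \<Rightarrow> (real \<Rightarrow> real) \<Rightarrow> (real \<Rightarrow> real) set" where
  "ord_int L \<alpha> \<beta> = {u. C2 L u \<and> (\<forall>x\<in>{0..L}. \<alpha> x \<le> u x \<and> u x \<le> \<beta> x \<and>
                              D2 L \<alpha> x \<ge> D2 L u x \<and> D2 L u x \<ge> D2 L \<beta> x)}"

definition iter_seq :: "real \<Rightarrow> real \<Rightarrow> real \<Rightarrow> real \<Rightarrow> (real \<Rightarrow> real) \<Rightarrow> real \<Rightarrow> real
    \<Rightarrow> (real \<Rightarrow> real) \<Rightarrow> (nat \<Rightarrow> real \<Rightarrow> real) \<Rightarrow> bool" where
  "iter_seq L a b c p M N y0 y \<longleftrightarrow> y 0 = y0 \<and>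
     (\<forall>n. W41 L (y (Suc n)) \<and> bc L (y (Suc n)) \<and>
        ae_on L (\<lambda>x. D4 L (y (Suc n)) x - M * D2 L (y (Suc n)) x + N * integral {0..L} (y (Suc n))
            = p x + (a + b * integral {0..L} (y n)) * D2 L (y n) x - c * integral {0..L} (y n)
              - M * D2 L (y n) x + N * integral {0..L} (y n)))"

end

theory Submission
  imports Defs
begin

text \<open>
  Put \<open>v = - w''\<close> and \<open>T w = w'''' - M w'' + N \<integral> w\<close>. Representing \<open>v\<close> by the Green function of
  \<open>M v - v''\<close> shows that \<open>T w \<ge> 0\<close> forces \<open>w \<ge> 0\<close> and \<open>w'' \<le> 0\<close>, the condition on \<open>N\<close> being exactly the
  corner value of the kernel inequality. Hence the iteration is monotone for the order
  \<open>y \<le> z \<and> y'' \<ge> z''\<close> and every iterate started in \<open>[\<alpha>, \<beta>]\<close> is squeezed between \<open>\<alpha>\<^sub>n\<close> and \<open>\<beta>\<^sub>n\<close>. The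
  additional hypothesis makes \<open>max (\<alpha>\<^sub>n'' - \<beta>\<^sub>n'')\<close> shrink by a factor of at least two in each step, so
  the squeeze converges to a fixed point. Uniqueness is the convergence of the constant iteration
  started at a second solution.

  Since \<open>D4\<close> is a pointwise derivative of the absolutely continuous \<open>w'''\<close>, Lebesgue's
  differentiation theorem on an interval is needed to identify it with the density of \<open>w'''\<close>.
\<close>

section \<open>Lebesgue differentiation on an interval\<close>

text \<open>The obstacle to positivity is the nonlocal term: nothing is known beforehand about the
  sign of W, the integral of \<open>w\<close>. Adding \<open>N * W * \<phi>\<close> to
  \<open>v\<close> leaves a local problem \<open>M u - u'' = h\<close> with
  \<open>h \<ge> 0\<close>. Testing it with \<open>\<theta>\<close> expresses W through the same
  \<open>h\<close>, namely \<open>W * (1 + N * K)\<close> is the integral of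
  \<open>\<theta> * h\<close>, where K is the integral of \<open>\<theta>\<close>. Hence
  \<open>W \<ge> 0\<close>, and \<open>v = u - N * W * \<phi>\<close> is a difference of two
  positive integral operators applied to one \<open>h\<close>: the Green kernel only has to dominate
  a rank-one kernel, a multiple of \<open>\<phi>(x) * \<theta>(s)\<close>.

  The squeeze controls functions and second derivatives only, so the limit is at first merely C2 and
  the fourth-order equation cannot be passed to the limit directly. One further step from the limit
  lies in W41, is trapped between the same bounds, and so coincides with the limit; its equation is
  then the nonlinear one. Estimates are made for second derivatives because zero boundary values
  recover the functions from them, by comparison with a parabola.\<close>

lemma indefinite_integral_has_derivative_ae:
  fixes f :: "real \<Rightarrow> real"
  assumes f: "f integrable_on {a..b}"
  obtains S where "negligible S"
    "\<And>x. x \<in> {a..b} - S \<Longrightarrow>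
      ((\<lambda>x. integral {a..x} f) has_real_derivative f x) (at x within {a..b})"
proof -
  define F where "F = (\<lambda>x. integral {a..x} f)"
  define B where "B e = {x \<in> {a..b}. \<forall>d>0. \<exists>y\<in>{a..b}. y \<noteq> x \<and> \<bar>y - x\<bar> < d \<and>
      \<bar>F y - F x - f x * (y - x)\<bar> > e * \<bar>y - x\<bar>}" for e
  have F: "integral {min x y..max x y} f = (if x \<le> y then F y - F x else F x - F y)"
    if "x \<in> {a..b}" "y \<in> {a..b}" for x y
  proof -
    have "F u + integral {u..v} f = F v" if "u \<in> {a..b}" "v \<in> {a..b}" "u \<le> v" for u v
      unfolding F_def using that f
      by (intro Henstock_Kurzweil_Integration.integral_combine) (auto intro: integrable_subinterval_real)
    from this[of x y] this[of y x] show ?thesis using that by (auto simp: min_def max_def)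
  qed
  \<comment> \<open>At a point of \<open>B e\<close> the increment of \<open>F\<close> misses
    \<open>f x * (y - x)\<close> by more than \<open>e\<close> times the length of some arbitrarily
    short interval. Henstock's lemma bounds the sum of such errors over disjoint tagged intervals,
    hence bounds their total length; Vitali's covering lemma passes from disjoint intervals to a
    cover of \<open>B e\<close>.\<close>
  have neg: "negligible (B e)" if "e > 0" for e
    unfolding negligible_outer_le
  proof (intro allI impI)
    fix \<epsilon> :: real assume "\<epsilon> > 0"
    \<comment> \<open>In the tolerance, \<open>e\<close> cancels against the size of the error per
      unit length, and 5 is the enlargement factor in Vitali's lemma.\<close>
    obtain \<gamma> where \<gamma>: "gauge \<gamma>"
      "\<And>p. p tagged_partial_division_of cbox a b \<Longrightarrow> \<gamma> fine p \<Longrightarrow>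
         (\<Sum>(x, k)\<in>p. norm (measure lborel k *\<^sub>R f x - integral k f)) < e * (\<epsilon> / 5)"
      using Henstock_lemma[of f a b "e * (\<epsilon> / 5)"] f \<open>e > 0\<close> \<open>\<epsilon> > 0\<close> by auto
    have "\<exists>y\<in>{a..b}. y \<noteq> x \<and> {min x y..max x y} \<subseteq> \<gamma> x \<and>
        \<bar>F y - F x - f x * (y - x)\<bar> > e * \<bar>y - x\<bar>" if "x \<in> B e" for x
    proof -
      obtain d where d: "d > 0" "ball x d \<subseteq> \<gamma> x"
        using \<gamma>(1) by (meson gauge_def open_contains_ball)
      then obtain y where y: "y \<in> {a..b}" "y \<noteq> x" "\<bar>y - x\<bar> < d"
        "\<bar>F y - F x - f x * (y - x)\<bar> > e * \<bar>y - x\<bar>"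
        using \<open>x \<in> B e\<close> unfolding B_def by blast
      have "{min x y..max x y} \<subseteq> ball x d"
        using y(3) by (auto simp: dist_real_def)
      then show ?thesis using y d by blast
    qed
    then obtain Y where Y: "\<And>x. x \<in> B e \<Longrightarrow> Y x \<in> {a..b} \<and> Y x \<noteq> x \<and> {min x (Y x)..max x (Y x)} \<subseteq> \<gamma> x
        \<and> \<bar>F (Y x) - F x - f x * (Y x - x)\<bar> > e * \<bar>Y x - x\<bar>"
      by metis
    \<comment> \<open>The interval between \<open>x\<close> and \<open>Y x\<close> is rewritten as a
      ball for the covering lemma. Its centre is the midpoint, while its tag remains the endpoint
      \<open>x\<close>.\<close>
    define r where "r x = \<bar>Y x - x\<bar> / 2" for x
    define c where "c x = (x + Y x) / 2" for x
    have cb: "cball (c x) (r x) = {min x (Y x)..max x (Y x)}" for x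
      unfolding cball_eq_atLeastAtMost c_def r_def by (auto simp: min_def max_def field_simps)
    have Bab: "x \<in> {a..b}" if "x \<in> B e" for x using that by (simp add: B_def)
    have rpos: "0 < r x \<and> r x \<le> b - a" if "x \<in> B e" for x
      using Y[OF that] Bab[OF that] by (auto simp: r_def)
    obtain C where C: "countable C" "C \<subseteq> B e"
      "pairwise (\<lambda>i j. disjnt (cball (c i) (r i)) (cball (c j) (r j))) C"
      "B e \<subseteq> (\<Union>i\<in>C. cball (c i) (5 * r i))"
    proof (rule Vitali_covering_lemma_cballs[where S = "B e" and K = "B e" and a = c and r = r and B = "b - a"])
      show "B e \<subseteq> (\<Union>i\<in>B e. cball (c i) (r i))" unfolding cb by force
    qed (use rpos in auto)
    have fin: "(\<Sum>x\<in>I. r x) \<le> \<epsilon> / 10" if I: "I \<subseteq> C" "finite I" for I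
    proof -
      define p where "p = (\<lambda>x. (x, cball (c x) (r x))) ` I"
      have part: "p tagged_partial_division_of cbox a b"
        unfolding tagged_partial_division_of_def
      proof (intro conjI allI impI)
        show "finite p" using I by (simp add: p_def)
      next
        fix x K assume "(x, K) \<in> p"
        then have "x \<in> B e" "K = {min x (Y x)..max x (Y x)}"
          using I C cb by (auto simp: p_def)
        with Y[of x] Bab[of x]
        show "x \<in> K" "K \<subseteq> cbox a b" "\<exists>a b. K = cbox a b" by auto
      next
        fix x1 K1 x2 K2 assume "(x1, K1) \<in> p \<and> (x2, K2) \<in> p \<and> (x1, K1) \<noteq> (x2, K2)"
        then have "x1 \<in> C" "x2 \<in> C" "x1 \<noteq> x2" and K: "K1 = cball (c x1) (r x1)" "K2 = cball (c x2) (r x2)"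
          using I by (auto simp: p_def)
        then have "K1 \<inter> K2 = {}"
          unfolding K using C(3) by (simp add: pairwise_def disjnt_def)
        then show "interior K1 \<inter> interior K2 = {}"
          using interior_subset by blast
      qed
      have fine: "\<gamma> fine p"
        unfolding fine_def p_def using Y I C(2) cb by auto
      have "(\<Sum>x\<in>I. e * (2 * r x)) \<le> (\<Sum>x\<in>I. norm (measure lborel (cball (c x) (r x)) *\<^sub>R f x - integral (cball (c x) (r x)) f))"
      proof (rule sum_mono)
        fix x assume "x \<in> I"
        then have x: "x \<in> B e" using I C by auto
        have "measure lborel (cball (c x) (r x)) *\<^sub>R f x - integral (cball (c x) (r x)) f
          = (if x \<le> Y x then - (F (Y x) - F x - f x * (Y x - x)) else (F (Y x) - F x - f x * (Y x - x)))"
          unfolding cb using F[of x "Y x"] Bab[OF x] Y[OF x]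
          by (simp add: min_def max_def algebra_simps)
        then show "e * (2 * r x) \<le> norm (measure lborel (cball (c x) (r x)) *\<^sub>R f x - integral (cball (c x) (r x)) f)"
          using Y[OF x] by (auto simp: r_def split: if_splits)
      qed
      also have "\<dots> = (\<Sum>(x, k)\<in>p. norm (measure lborel k *\<^sub>R f x - integral k f))"
        unfolding p_def by (subst sum.reindex) (auto simp: inj_on_def)
      also have "\<dots> < e * (\<epsilon> / 5)" by (rule \<gamma>(2)[OF part fine])
      finally have "e * (2 * (\<Sum>x\<in>I. r x)) < e * (\<epsilon> / 5)" by (simp add: sum_distrib_left)
      then show ?thesis using \<open>e > 0\<close> by simp
    qed
    have lee: "measure lebesgue (\<Union>x\<in>I. cball (c x) (5 * r x)) \<le> \<epsilon>" if I: "I \<subseteq> C" "finite I" for I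
    proof -
      have "measure lebesgue (\<Union>x\<in>I. cball (c x) (5 * r x)) \<le> (\<Sum>x\<in>I. measure lebesgue (cball (c x) (5 * r x)))"
        using I by (intro measure_UNION_le) auto
      also have "\<dots> = (\<Sum>x\<in>I. 10 * r x)"
        by (rule sum.cong) (auto simp: cball_eq_atLeastAtMost r_def)
      also have "\<dots> \<le> \<epsilon>" using fin[OF I] by (simp add: sum_distrib_left[symmetric])
      finally show ?thesis .
    qed
    show "\<exists>T. B e \<subseteq> T \<and> T \<in> lmeasurable \<and> measure lebesgue T \<le> \<epsilon>"
      using C lee \<open>\<epsilon> > 0\<close>
      by (intro exI[of _ "\<Union>x\<in>C. cball (c x) (5 * r x)"] conjI
          fmeasurable_UN_bound[OF \<open>countable C\<close>] measure_UN_bound[OF \<open>countable C\<close>]) auto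
  qed
  show ?thesis
  proof (rule that[of "\<Union>n. B (inverse (real (Suc n)))"])
    show "negligible (\<Union>n. B (inverse (real (Suc n))))"
      by (rule negligible_Union_nat) (auto intro!: neg)
    fix x assume x: "x \<in> {a..b} - (\<Union>n. B (inverse (real (Suc n))))"
    show "((\<lambda>x. integral {a..x} f) has_real_derivative f x) (at x within {a..b})"
      unfolding has_field_derivative_def has_derivative_within_alt
    proof (intro conjI allI impI)
      fix e :: real assume "e > 0"
      then obtain n where n: "inverse (real (Suc n)) < e" using reals_Archimedean by blast
      have "x \<notin> B (inverse (real (Suc n)))" "x \<in> {a..b}" using x by auto
      then obtain d where d: "d > 0" "\<not> (\<exists>y\<in>{a..b}. y \<noteq> x \<and> \<bar>y - x\<bar> < d \<and>
          \<bar>F y - F x - f x * (y - x)\<bar> > inverse (real (Suc n)) * \<bar>y - x\<bar>)"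
        unfolding B_def by blast
      have "\<bar>F y - F x - f x * (y - x)\<bar> \<le> e * \<bar>y - x\<bar>" if "y \<in> {a..b}" "\<bar>y - x\<bar> < d" for y
      proof (cases "y = x")
        case False
        have "inverse (real (Suc n)) * \<bar>y - x\<bar> \<le> e * \<bar>y - x\<bar>"
          using n by (intro mult_right_mono) auto
        moreover have "\<bar>F y - F x - f x * (y - x)\<bar> \<le> inverse (real (Suc n)) * \<bar>y - x\<bar>"
          using d(2) that False by (meson not_le)
        ultimately show ?thesis by linarith
      qed simp
      with d(1) show "\<exists>d>0. \<forall>y\<in>{a..b}. norm (y - x) < d \<longrightarrow>
          norm (integral {a..y} f - integral {a..x} f - f x * (y - x)) \<le> e * norm (y - x)"
        unfolding F_def by auto
    qed (rule bounded_linear_mult_right)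
  qed
qed

section \<open>Primitives of integrable functions\<close>

text \<open>Absolute continuity together with a chosen density. The density is free on null sets and
  no pointwise derivative of \<open>F\<close> is asked for, which is the regularity that a third
  derivative has in W41.\<close>

definition primitive_on :: "real \<Rightarrow> real \<Rightarrow> (real \<Rightarrow> real) \<Rightarrow> (real \<Rightarrow> real) \<Rightarrow> bool" where
  "primitive_on a b F f \<longleftrightarrow> f absolutely_integrable_on {a..b} \<and>
     (\<forall>x\<in>{a..b}. F x = F a + integral {a..x} f)"

lemma primitive_on_integral:
  "primitive_on a b F f \<Longrightarrow> x \<in> {a..b} \<Longrightarrow> F x = F a + integral {a..x} f"
  unfolding primitive_on_def by blast

lemma primitive_on_integrable:
  "primitive_on a b F f \<Longrightarrow> f absolutely_integrable_on {a..b}"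
  unfolding primitive_on_def by blast

lemma primitive_on_diff:
  assumes "primitive_on a b F f" "a \<le> x" "x \<le> y" "y \<le> b"
  shows "F y - F x = integral {x..y} f"
proof -
  have "f integrable_on {a..y}"
    using primitive_on_integrable[OF assms(1)] assms
    by (auto intro: integrable_subinterval_real dest: absolutely_integrable_on_def[THEN iffD1])
  then have "integral {a..x} f + integral {x..y} f = integral {a..y} f"
    using assms by (intro Henstock_Kurzweil_Integration.integral_combine) auto
  then show ?thesis
    using primitive_on_integral[OF assms(1), of x] primitive_on_integral[OF assms(1), of y] assms(2-4) by simp
qed

lemma primitive_on_subinterval:
  assumes "primitive_on a b F f" "a \<le> c" "d \<le> b"
  shows "primitive_on c d F f"
  unfolding primitive_on_def
proof
  show "f absolutely_integrable_on {c..d}"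
    using primitive_on_integrable[OF assms(1)] assms by (auto intro: absolutely_integrable_on_subinterval)
  show "\<forall>x\<in>{c..d}. F x = F c + integral {c..x} f"
    using primitive_on_diff[OF assms(1,2)] assms(3) by force
qed

lemma primitive_on_lincomb:
  assumes "primitive_on a b F f" "primitive_on a b G g"
  shows "primitive_on a b (\<lambda>x. r * F x + s * G x) (\<lambda>x. r * f x + s * g x)"
  unfolding primitive_on_def
proof
  have f: "f absolutely_integrable_on {a..b}" and g: "g absolutely_integrable_on {a..b}"
    using assms by (auto dest: primitive_on_integrable)
  show "(\<lambda>x. r * f x + s * g x) absolutely_integrable_on {a..b}"
    using f g by (intro set_integral_add set_integrable_mult_right) auto
  show "\<forall>x\<in>{a..b}. r * F x + s * G x = r * F a + s * G a + integral {a..x} (\<lambda>x. r * f x + s * g x)"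
  proof
    fix x assume x: "x \<in> {a..b}"
    have "f integrable_on {a..x}" "g integrable_on {a..x}"
      using f g x by (auto intro: integrable_subinterval_real dest: absolutely_integrable_on_def[THEN iffD1])
    then have "integral {a..x} (\<lambda>x. r * f x + s * g x) = r * integral {a..x} f + s * integral {a..x} g"
      by (simp add: integral_add integrable_on_mult_right)
    then show "r * F x + s * G x = r * F a + s * G a + integral {a..x} (\<lambda>x. r * f x + s * g x)"
      unfolding primitive_on_integral[OF assms(1) x] primitive_on_integral[OF assms(2) x]
      by (simp add: algebra_simps)
  qed
qed

lemma primitive_on_C1:
  assumes "\<And>x. x \<in> {a..b} \<Longrightarrow> (F has_real_derivative f x) (at x within {a..b})"
    and "continuous_on {a..b} f"
  shows "primitive_on a b F f"
  unfolding primitive_on_def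
proof
  show "f absolutely_integrable_on {a..b}"
    using assms(2) by (rule absolutely_integrable_continuous_real)
  show "\<forall>x\<in>{a..b}. F x = F a + integral {a..x} f"
  proof
    fix x assume x: "x \<in> {a..b}"
    have "(f has_integral F x - F a) {a..x}"
    proof (rule fundamental_theorem_of_calculus)
      fix s assume "s \<in> {a..x}"
      then have "(F has_real_derivative f s) (at s within {a..x})"
        using assms(1)[of s] x by (auto intro: has_field_derivative_subset)
      then show "(F has_vector_derivative f s) (at s within {a..x})"
        by (simp add: has_real_derivative_iff_has_vector_derivative)
    qed (use x in auto)
    then show "F x = F a + integral {a..x} f" by (simp add: integral_unique)
  qed
qed

lemma primitive_on_continuous:
  assumes "primitive_on a b F f"
  shows "continuous_on {a..b} F"
proof -
  have "f integrable_on {a..b}"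
    using primitive_on_integrable[OF assms] by (auto dest: absolutely_integrable_on_def[THEN iffD1])
  then have "continuous_on {a..b} (\<lambda>x. F a + integral {a..x} f)"
    by (intro continuous_intros indefinite_integral_continuous_1)
  then show ?thesis
    using assms unfolding primitive_on_def by (metis (no_types, lifting) continuous_on_eq)
qed

lemma continuous_mult_absolutely_integrable:
  fixes k f :: "real \<Rightarrow> real"
  assumes "continuous_on {a..b} k" "f absolutely_integrable_on {a..b}"
  shows "(\<lambda>x. k x * f x) absolutely_integrable_on {a..b}"
  using assms
  by (intro absolutely_integrable_bounded_measurable_product_real
      continuous_imp_measurable_on_sets_lebesgue compact_imp_bounded compact_continuous_image) auto

text \<open>The defect \<open>\<integral>(k f + k' F) - k F\<close> has increments of size \<open>O(\<bar>y - x\<bar> \<integral>\<^sub>x\<^sup>y \<bar>f\<bar>)\<close>, so it is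
  differentiable everywhere with derivative zero, although \<open>F\<close> itself need not be differentiable.\<close>

lemma integral_by_parts_primitive:
  assumes ab: "a \<le> b" and F: "primitive_on a b F f"
    and k: "\<And>x. x \<in> {a..b} \<Longrightarrow> (k has_real_derivative k' x) (at x within {a..b})"
    and k': "continuous_on {a..b} k'"
  shows "integral {a..b} (\<lambda>s. k s * f s) = k b * F b - k a * F a - integral {a..b} (\<lambda>s. k' s * F s)"
proof -
  have kc: "continuous_on {a..b} k" by (rule DERIV_continuous_on[OF k])
  have Fc: "continuous_on {a..b} F" by (rule primitive_on_continuous[OF F])
  have K: "primitive_on a b k k'" by (rule primitive_on_C1[OF k k'])
  have f: "f absolutely_integrable_on {a..b}" by (rule primitive_on_integrable[OF F])
  have af: "(\<lambda>s. \<bar>f s\<bar>) integrable_on {a..b}"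
    using f by (auto simp: absolutely_integrable_on_def)
  define J where "J x = integral {a..x} (\<lambda>s. \<bar>f s\<bar>)" for x
  have Jc: "continuous_on {a..b} J"
    unfolding J_def by (intro indefinite_integral_continuous_1 af)
  have J: "primitive_on a b J (\<lambda>s. \<bar>f s\<bar>)"
    unfolding primitive_on_def J_def using f by (auto simp: absolutely_integrable_abs_iff set_integrable_abs)
  define G where "G x = integral {a..x} (\<lambda>s. k s * f s + k' s * F s)" for x
  have kf: "(\<lambda>s. k s * f s) absolutely_integrable_on {a..b}"
    by (rule continuous_mult_absolutely_integrable[OF kc f])
  have kF: "(\<lambda>s. k' s * F s) absolutely_integrable_on {a..b}"
    by (intro absolutely_integrable_continuous_real continuous_intros k' Fc)
  have G: "primitive_on a b G (\<lambda>s. k s * f s + k' s * F s)"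
    unfolding primitive_on_def G_def using kf kF by (auto intro!: set_integral_add)
  have "bounded (k' ` {a..b})"
    using k' compact_continuous_image compact_imp_bounded by blast
  then obtain C where C: "C > 0" "\<And>x. x \<in> {a..b} \<Longrightarrow> \<bar>k' x\<bar> \<le> C"
    unfolding bounded_pos by auto
  define P where "P x = G x - k x * F x" for x
  have inc: "\<bar>P y - P x\<bar> \<le> 2 * C * \<bar>J y - J x\<bar> * \<bar>y - x\<bar>"
    if xy: "a \<le> x" "x \<le> y" "y \<le> b" for x y
  proof -
    have sub: "{x..y} \<subseteq> {a..b}" using xy by auto
    have int: "f integrable_on {x..y}" "k' integrable_on {x..y}"
        "(\<lambda>s. \<bar>f s\<bar>) integrable_on {x..y}" "(\<lambda>s. k s * f s + k' s * F s) integrable_on {x..y}"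
      using f af kf kF integrable_continuous_real[OF k']
      by (auto intro!: integrable_subinterval_real[OF _ sub] integrable_add
          simp: absolutely_integrable_on_def)
    have JJ: "J v - J u = integral {u..v} (\<lambda>s. \<bar>f s\<bar>)" if "x \<le> u" "u \<le> v" "v \<le> y" for u v
      using primitive_on_diff[OF J] that xy by auto
    have Jmono: "0 \<le> J v - J u" if "x \<le> u" "u \<le> v" "v \<le> y" for u v
      using JJ[OF that] int(3) that
      by (auto intro!: integral_nonneg integrable_subinterval_real[OF int(3)])
    \<comment> \<open>The increment of the product is split exactly as
      \<open>k y * (F y - F x) + F x * (k y - k x)\<close>. With these frozen factors the integrand
      becomes \<open>(k s - k y) * f s + k' s * (F s - F x)\<close>, and both brackets are
      small.\<close>
    have "P y - P x = integral {x..y} (\<lambda>s. k s * f s + k' s * F s)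
        - (k y * integral {x..y} f + F x * integral {x..y} k')"
      using primitive_on_diff[OF G xy] primitive_on_diff[OF F xy] primitive_on_diff[OF K xy]
      by (simp add: P_def algebra_simps)
    also have "\<dots> = integral {x..y} (\<lambda>s. (k s * f s + k' s * F s) - (k y * f s + F x * k' s))"
      using int by (simp add: integral_diff integral_add integrable_add integrable_on_mult_right)
    finally have eq: "P y - P x = integral {x..y} (\<lambda>s. (k s * f s + k' s * F s) - (k y * f s + F x * k' s))" .
    have "\<bar>P y - P x\<bar> \<le> integral {x..y} (\<lambda>s. C * (y - x) * \<bar>f s\<bar> + C * (J y - J x))"
      unfolding real_norm_def[symmetric] eq
    proof (rule integral_norm_bound_integral)
      show "(\<lambda>s. (k s * f s + k' s * F s) - (k y * f s + F x * k' s)) integrable_on {x..y}"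
        using int(1,2) by (intro integrable_diff[OF int(4)] integrable_add integrable_on_mult_right)
      show "(\<lambda>s. C * (y - x) * norm (f s) + C * (J y - J x)) integrable_on {x..y}"
        using int by (intro integrable_add integrable_on_mult_right) auto
      fix s assume s: "s \<in> {x..y}"
      have "\<bar>k y - k s\<bar> \<le> C * (y - s)"
      proof -
        have "\<bar>integral {s..y} k'\<bar> \<le> C * (y - s)"
          using integral_bound[of s y k' C] C s xy continuous_on_subset[OF k', of "{s..y}"] by auto
        then show ?thesis using primitive_on_diff[OF K, of s y] s xy by auto
      qed
      also have "\<dots> \<le> C * (y - x)" using s C by auto
      finally have 1: "\<bar>k s - k y\<bar> \<le> C * (y - x)" by simp
      have "\<bar>F s - F x\<bar> \<le> J s - J x"
      proof -
        have "norm (integral {x..s} f) \<le> integral {x..s} (\<lambda>s. \<bar>f s\<bar>)"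
          using int s by (intro integral_norm_bound_integral)
            (auto intro: integrable_subinterval_real[OF int(1)] integrable_subinterval_real[OF int(3)])
        then show ?thesis using primitive_on_diff[OF F, of x s] JJ[of x s] s xy by auto
      qed
      also have "\<dots> \<le> J y - J x" using Jmono[of s y] s by auto
      finally have 2: "\<bar>F s - F x\<bar> \<le> J y - J x" .
      have "norm ((k s * f s + k' s * F s) - (k y * f s + F x * k' s))
          = \<bar>(k s - k y) * f s + k' s * (F s - F x)\<bar>" by (simp add: algebra_simps)
      also have "\<dots> \<le> \<bar>k s - k y\<bar> * \<bar>f s\<bar> + \<bar>k' s\<bar> * \<bar>F s - F x\<bar>"
        by (metis abs_mult abs_triangle_ineq)
      also have "\<dots> \<le> C * (y - x) * \<bar>f s\<bar> + C * (J y - J x)"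
        using 1 2 C s xy by (intro add_mono mult_mono) auto
      finally show "norm ((k s * f s + k' s * F s) - (k y * f s + F x * k' s))
          \<le> C * (y - x) * norm (f s) + C * (J y - J x)" by simp
    qed
    also have "\<dots> = C * (y - x) * (J y - J x) + C * (J y - J x) * (y - x)"
    proof -
      have i: "(\<lambda>s. C * (y - x) * \<bar>f s\<bar>) integrable_on {x..y}"
        using int(3) by (rule integrable_on_mult_right)
      have c: "(\<lambda>s. C * (J y - J x)) integrable_on {x..y}"
        by (intro integrable_continuous_real continuous_intros)
      have "integral {x..y} (\<lambda>s. C * (y - x) * \<bar>f s\<bar> + C * (J y - J x))
        = integral {x..y} (\<lambda>s. C * (y - x) * \<bar>f s\<bar>) + integral {x..y} (\<lambda>s. C * (J y - J x))"
        by (rule integral_add[OF i c])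
      also have "\<dots> = C * (y - x) * integral {x..y} (\<lambda>s. \<bar>f s\<bar>) + C * (J y - J x) * (y - x)"
        using xy(2) by (simp only: integral_mult_right integral_const_real measure_lborel_Icc) simp
      finally show ?thesis unfolding JJ[OF order_refl xy(2) order_refl, symmetric] .
    qed
    also have "\<dots> = 2 * C * \<bar>J y - J x\<bar> * \<bar>y - x\<bar>"
      using Jmono[OF order_refl xy(2) order_refl] xy by (simp add: abs_of_nonneg)
    finally show ?thesis .
  qed
  have inc': "\<bar>P y - P x\<bar> \<le> 2 * C * \<bar>J y - J x\<bar> * \<bar>y - x\<bar>" if "x \<in> {a..b}" "y \<in> {a..b}" for x y
    using inc[of x y] inc[of y x] that by (cases "x \<le> y") (auto simp: abs_minus_commute)
  have "\<exists>c. \<forall>x\<in>{a..b}. P x = c"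
  proof (rule has_field_derivative_zero_constant)
    fix x assume x: "x \<in> {a..b}"
    show "(P has_real_derivative 0) (at x within {a..b})"
      unfolding has_field_derivative_def has_derivative_within_alt
    proof (intro conjI allI impI)
      fix e :: real assume "e > 0"
      then have "e / (2 * C) > 0" using C by simp
      then obtain d where d: "d > 0" "\<And>y. y \<in> {a..b} \<Longrightarrow> \<bar>y - x\<bar> < d \<Longrightarrow> \<bar>J y - J x\<bar> < e / (2 * C)"
        using Jc x unfolding continuous_on_iff dist_real_def by meson
      have "\<bar>P y - P x\<bar> \<le> e * \<bar>y - x\<bar>" if "y \<in> {a..b}" "\<bar>y - x\<bar> < d" for y
      proof -
        have "2 * C * \<bar>J y - J x\<bar> \<le> e" using d(2)[OF that] C by (simp add: field_simps)
        then have "2 * C * \<bar>J y - J x\<bar> * \<bar>y - x\<bar> \<le> e * \<bar>y - x\<bar>" by (rule mult_right_mono) simp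
        then show ?thesis using inc'[OF x that(1)] by linarith
      qed
      then show "\<exists>d>0. \<forall>y\<in>{a..b}. norm (y - x) < d \<longrightarrow> norm (P y - P x - 0 * (y - x)) \<le> e * norm (y - x)"
        using d(1) by auto
    qed (rule bounded_linear_mult_right)
  qed simp
  then have "P b = P a" using ab by auto
  moreover have "G a = 0" by (simp add: G_def)
  moreover have "G b = integral {a..b} (\<lambda>s. k s * f s) + integral {a..b} (\<lambda>s. k' s * F s)"
    unfolding G_def using kf kF by (intro integral_add) (auto dest: absolutely_integrable_on_def[THEN iffD1])
  ultimately show ?thesis by (simp add: P_def)
qed

text \<open>Lagrange's identity with \<open>f\<close> in the role of the second derivative of
  \<open>v\<close>. Two integrations by parts: the first moves onto \<open>k\<close> the derivative
  that exists only as a density, the second involves C1 functions. The coefficient \<open>M\<close>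
  is free, so that \<open>M = 0\<close> covers the plain second derivative.\<close>

lemma green_identity:
  assumes ab: "a \<le> b"
    and v: "\<And>x. x \<in> {a..b} \<Longrightarrow> (v has_real_derivative v1 x) (at x within {a..b})"
    and v1: "primitive_on a b v1 f"
    and k: "\<And>x. (k has_real_derivative k1 x) (at x)"
    and k1: "\<And>x. (k1 has_real_derivative k2 x) (at x)"
    and k2: "continuous_on {a..b} k2"
  shows "integral {a..b} (\<lambda>s. k s * (M * v s - f s))
    = (k1 b * v b - k b * v1 b) - (k1 a * v a - k a * v1 a) + integral {a..b} (\<lambda>s. (M * k s - k2 s) * v s)"
proof -
  have kc: "continuous_on {a..b} k" and k1c: "continuous_on {a..b} k1"
    using k k1 by (auto intro!: DERIV_continuous_on intro: has_field_derivative_at_within)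
  have v1c: "continuous_on {a..b} v1" by (rule primitive_on_continuous[OF v1])
  have vc: "continuous_on {a..b} v" by (rule DERIV_continuous_on[OF v])
  have V: "primitive_on a b v v1" by (rule primitive_on_C1[OF v v1c])
  have 1: "integral {a..b} (\<lambda>s. k s * f s) = k b * v1 b - k a * v1 a - integral {a..b} (\<lambda>s. k1 s * v1 s)"
    using k by (intro integral_by_parts_primitive[OF ab v1 _ k1c]) (auto intro: has_field_derivative_at_within)
  have 2: "integral {a..b} (\<lambda>s. k1 s * v1 s) = k1 b * v b - k1 a * v a - integral {a..b} (\<lambda>s. k2 s * v s)"
    using k1 by (intro integral_by_parts_primitive[OF ab V _ k2]) (auto intro: has_field_derivative_at_within)
  have i1: "(\<lambda>s. k s * f s) integrable_on {a..b}"
    using continuous_mult_absolutely_integrable[OF kc primitive_on_integrable[OF v1]]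
    by (auto simp: absolutely_integrable_on_def)
  have i2: "(\<lambda>s. M * k s * v s) integrable_on {a..b}" "(\<lambda>s. k2 s * v s) integrable_on {a..b}"
    by (intro integrable_continuous_real continuous_intros kc vc k2)+
  have "integral {a..b} (\<lambda>s. k s * (M * v s - f s)) = integral {a..b} (\<lambda>s. M * k s * v s - k s * f s)"
    by (simp add: algebra_simps)
  also have "\<dots> = integral {a..b} (\<lambda>s. M * k s * v s) - integral {a..b} (\<lambda>s. k s * f s)"
    by (rule integral_diff[OF i2(1) i1])
  finally have 3: "integral {a..b} (\<lambda>s. k s * (M * v s - f s)) =
     integral {a..b} (\<lambda>s. M * k s * v s) - integral {a..b} (\<lambda>s. k s * f s)" .
  have "integral {a..b} (\<lambda>s. (M * k s - k2 s) * v s) = integral {a..b} (\<lambda>s. M * k s * v s - k2 s * v s)"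
    by (simp add: algebra_simps)
  also have "\<dots> = integral {a..b} (\<lambda>s. M * k s * v s) - integral {a..b} (\<lambda>s. k2 s * v s)"
    by (rule integral_diff[OF i2])
  finally show ?thesis using 1 2 3 by simp
qed

section \<open>The Green function and positivity\<close>

text \<open>Resetting \<open>f\<close> to 0 on \<open>Z\<close> does not change the integral and
  makes the sign pointwise. If the result fails to be integrable, its integral is 0 by
  default.\<close>

lemma integral_nonneg_ae:
  fixes f :: "real \<Rightarrow> real"
  assumes "negligible Z" "\<And>x. x \<in> T - Z \<Longrightarrow> 0 \<le> f x"
  shows "0 \<le> integral T f"
proof -
  have "integral T f = integral T (\<lambda>x. if x \<in> Z then 0 else f x)"
    by (rule integral_spike[OF assms(1)]) auto
  also have "0 \<le> \<dots>"
  proof (cases "(\<lambda>x. if x \<in> Z then 0 else f x) integrable_on T")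
    case True
    then show ?thesis by (rule integral_nonneg) (use assms(2) in auto)
  qed (simp add: not_integrable_integral)
  finally show ?thesis .
qed

lemma integral_le_ae:
  fixes f g :: "real \<Rightarrow> real"
  assumes "negligible Z" "\<And>x. x \<in> T - Z \<Longrightarrow> f x \<le> g x"
    "f integrable_on T" "g integrable_on T"
  shows "integral T f \<le> integral T g"
  using integral_nonneg_ae[of Z T "\<lambda>x. g x - f x"] assms by (simp add: integral_diff)

text \<open>\<open>S s\<close> and \<open>S (L - s)\<close> solve the homogeneous equation, one
  vanishing at 0 and the other at \<open>L\<close>. Green's identity with the first on
  \<open>{0..x}\<close> and the second on \<open>{x..L}\<close> leaves only boundary terms at
  \<open>x\<close>; in the combination below the terms with \<open>v1 x\<close> cancel and the
  factor of \<open>v x\<close> is the Wronskian \<open>\<kappa>\<close>.\<close>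

lemma green_representation:
  assumes x: "x \<in> {0..L}"
    and v: "\<And>x. x \<in> {0..L} \<Longrightarrow> (v has_real_derivative v1 x) (at x within {0..L})"
    and v1: "primitive_on 0 L v1 f" and bd: "v 0 = 0" "v L = 0"
    and S: "\<And>x. (S has_real_derivative S1 x) (at x)" "S 0 = 0"
    and S1: "\<And>x. (S1 has_real_derivative M * S x) (at x)"
    and wronskian: "S (L - x) * S1 x + S x * S1 (L - x) = \<kappa>"
  shows "\<kappa> * v x = S (L - x) * integral {0..x} (\<lambda>s. S s * (M * v s - f s))
                + S x * integral {x..L} (\<lambda>s. S (L - s) * (M * v s - f s))"
proof -
  have Sc: "continuous_on A S" for A
    using S(1) by (auto intro!: DERIV_continuous_on intro: has_field_derivative_at_within)
  have "integral {0..x} (\<lambda>s. S s * (M * v s - f s))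
    = (S1 x * v x - S x * v1 x) - (S1 0 * v 0 - S 0 * v1 0) + integral {0..x} (\<lambda>s. (M * S s - M * S s) * v s)"
  proof (rule green_identity)
    show "(v has_real_derivative v1 s) (at s within {0..x})" if "s \<in> {0..x}" for s
      using v[of s] that x by (auto intro: has_field_derivative_subset)
    show "primitive_on 0 x v1 f" using primitive_on_subinterval[OF v1] x by auto
  qed (use x S S1 Sc in \<open>auto intro!: continuous_intros\<close>)
  then have 1: "integral {0..x} (\<lambda>s. S s * (M * v s - f s)) = S1 x * v x - S x * v1 x"
    using bd S(2) by simp
  have d1: "((\<lambda>s. S (L - s)) has_real_derivative - S1 (L - s)) (at s)" for s
    by (rule DERIV_chain2[OF S(1), THEN DERIV_cong]) (auto intro!: derivative_eq_intros)
  have d2: "((\<lambda>s. - S1 (L - s)) has_real_derivative M * S (L - s)) (at s)" for s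
    by (rule DERIV_minus[OF DERIV_chain2[OF S1], THEN DERIV_cong]) (auto intro!: derivative_eq_intros)
  have "integral {x..L} (\<lambda>s. S (L - s) * (M * v s - f s))
    = (- S1 (L - L) * v L - S (L - L) * v1 L) - (- S1 (L - x) * v x - S (L - x) * v1 x)
      + integral {x..L} (\<lambda>s. (M * S (L - s) - M * S (L - s)) * v s)"
  proof (rule green_identity)
    show "(v has_real_derivative v1 s) (at s within {x..L})" if "s \<in> {x..L}" for s
      using v[of s] that x by (auto intro: has_field_derivative_subset)
    show "primitive_on x L v1 f" using primitive_on_subinterval[OF v1] x by auto
    show "continuous_on {x..L} (\<lambda>s. M * S (L - s))"
      by (intro continuous_intros continuous_on_compose2[OF Sc[of UNIV]]) auto
  qed (use x d1 d2 in auto)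
  then have 2: "integral {x..L} (\<lambda>s. S (L - s) * (M * v s - f s)) = S1 (L - x) * v x + S (L - x) * v1 x"
    using bd S(2) by simp
  show ?thesis unfolding 1 2 wronskian[symmetric] by (simp add: algebra_simps)
qed

lemma green_nonneg:
  assumes x: "x \<in> {0..L}"
    and v: "\<And>x. x \<in> {0..L} \<Longrightarrow> (v has_real_derivative v1 x) (at x within {0..L})"
    and v1: "primitive_on 0 L v1 f" and bd: "v 0 = 0" "v L = 0"
    and S: "\<And>x. (S has_real_derivative S1 x) (at x)" "S 0 = 0"
    and S1: "\<And>x. (S1 has_real_derivative M * S x) (at x)"
    and wronskian: "S (L - x) * S1 x + S x * S1 (L - x) = \<kappa>" and "\<kappa> > 0"
    and Snonneg: "\<And>x. x \<ge> 0 \<Longrightarrow> S x \<ge> 0"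
    and ae: "negligible Z" "\<And>s. s \<in> {0..L} - Z \<Longrightarrow> 0 \<le> M * v s - f s"
  shows "0 \<le> v x"
proof -
  have "0 \<le> integral {0..x} (\<lambda>s. S s * (M * v s - f s))"
    using x ae Snonneg by (intro integral_nonneg_ae[of Z] mult_nonneg_nonneg) auto
  moreover have "0 \<le> integral {x..L} (\<lambda>s. S (L - s) * (M * v s - f s))"
    using x ae Snonneg by (intro integral_nonneg_ae[of Z] mult_nonneg_nonneg) auto
  ultimately have "0 \<le> \<kappa> * v x"
    using green_representation[OF x v v1 bd S S1 wronskian] Snonneg[of x] Snonneg[of "L - x"] x by simp
  then show ?thesis using \<open>\<kappa> > 0\<close> by (simp add: zero_le_mult_iff)
qed

text \<open>The Green kernel for \<open>M = 0\<close>, where \<open>S\<close> is the identity and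
  the Wronskian is \<open>L\<close>.\<close>

lemma concave_nonneg:
  assumes x: "x \<in> {0..L}" and "L > 0"
    and v: "\<And>x. x \<in> {0..L} \<Longrightarrow> (v has_real_derivative v1 x) (at x within {0..L})"
    and v1: "primitive_on 0 L v1 f" and bd: "v 0 = 0" "v L = 0"
    and ae: "negligible Z" "\<And>s. s \<in> {0..L} - Z \<Longrightarrow> f s \<le> 0"
  shows "0 \<le> v x"
  by (rule green_nonneg[OF x v v1 bd, of "\<lambda>x. x" "\<lambda>x. 1" 0 L Z])
    (use assms in \<open>auto intro!: derivative_eq_intros\<close>)

section \<open>Elementary inequalities for hyperbolic functions\<close>

text \<open>In half-angle form this is \<open>tanh (y / 2) < y / 2\<close>. It gives both the
  positivity of \<open>\<theta>1\<close> and the upper bound for \<open>\<theta>\<close>.\<close>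

lemma half_mult_sinh_gt_cosh:
  fixes y :: real
  assumes "y > 0"
  shows "cosh y - 1 < y * sinh y / 2"
proof -
  have sinh_lt: "sinh z < z * cosh z" if "z > 0" for z :: real
  proof -
    have "(\<lambda>z. z * cosh z - sinh z) 0 < (\<lambda>z. z * cosh z - sinh z) z"
    proof (rule DERIV_pos_imp_increasing_open[OF that])
      fix x :: real assume "0 < x"
      then show "\<exists>y. ((\<lambda>z. z * cosh z - sinh z) has_real_derivative y) (at x) \<and> 0 < y"
        by (intro exI[of _ "x * sinh x"]) (auto intro!: derivative_eq_intros)
    qed (auto intro!: continuous_intros)
    then show ?thesis by simp
  qed
  have "(\<lambda>z. z * sinh z / 2 - cosh z) 0 < (\<lambda>z. z * sinh z / 2 - cosh z) y"
  proof (rule DERIV_pos_imp_increasing_open[OF assms])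
    fix x :: real assume "0 < x"
    then show "\<exists>y. ((\<lambda>z. z * sinh z / 2 - cosh z) has_real_derivative y) (at x) \<and> 0 < y"
      using sinh_lt[of x]
      by (intro exI[of _ "(x * cosh x - sinh x) / 2"]) (auto intro!: derivative_eq_intros simp: field_simps)
  qed (auto intro!: continuous_intros)
  then show ?thesis by simp
qed

lemma sinh_ge_self:
  fixes y :: real
  assumes "y \<ge> 0"
  shows "y \<le> sinh y"
proof -
  have "(\<lambda>z. sinh z - z) 0 \<le> (\<lambda>z. sinh z - z) y"
  proof (rule DERIV_nonneg_imp_nondecreasing[OF assms])
    fix x :: real
    show "\<exists>y. ((\<lambda>z. sinh z - z) has_real_derivative y) (at x) \<and> 0 \<le> y"
      by (intro exI[of _ "cosh x - 1"]) (auto intro!: derivative_eq_intros simp: cosh_real_ge_1)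
  qed
  then show ?thesis by simp
qed

text \<open>With \<open>m = sqrt M\<close>: \<open>\<phi>\<close> and \<open>\<theta>\<close> are the solutions of \<open>M u - u'' = 1\<close> and
  \<open>M u - u'' = \<psi>\<close> vanishing at \<open>0\<close> and \<open>L\<close>, where \<open>\<psi>\<close> is the one of \<open>- u'' = 1\<close>; and
  \<open>\<tau> = tanh (m L / 2)\<close>, so that \<open>\<phi>'(0) = \<tau> / m\<close> and \<open>\<theta>'(0) = \<theta>1\<close>.\<close>

locale beam_kernel =
  fixes L m :: real
  assumes L: "L > 0" and m: "m > 0"
begin

definition "\<tau> = (cosh (m * L) - 1) / sinh (m * L)"
definition "\<phi> x = (\<tau> * sinh (m * x) - cosh (m * x) + 1) / m^2"
definition "\<phi>d x = (\<tau> * cosh (m * x) - sinh (m * x)) / m"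
definition "\<psi> x = x * (L - x) / 2"
definition "\<theta> x = (\<psi> x - \<phi> x) / m^2"
definition "\<theta>d x = ((L - 2 * x) / 2 - \<phi>d x) / m^2"
definition "\<theta>1 = (L / 2 - \<tau> / m) / m^2"

lemma mL_pos: "m * L > 0" "sinh (m * L) > 0"
  using L m by auto

lemma \<tau>_sinh: "\<tau> * sinh (m * L) = cosh (m * L) - 1"
  using mL_pos by (simp add: \<tau>_def)

lemma \<tau>_pos: "\<tau> > 0"
  using mL_pos cosh_real_strict_mono[of 0 "m * L"] unfolding \<tau>_def by (intro divide_pos_pos) auto

lemma \<tau>_cosh: "\<tau> * cosh (m * L) = sinh (m * L) - \<tau>"
proof -
  have "(\<tau> * cosh (m * L)) * sinh (m * L) = (sinh (m * L) - \<tau>) * sinh (m * L)"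
    using \<tau>_sinh hyperbolic_pythagoras[of "m * L"] by algebra
  then show ?thesis using mL_pos(2) by (metis less_irrefl mult_right_cancel)
qed

lemma deriv_\<phi>: "(\<phi> has_real_derivative \<phi>d x) (at x)"
  unfolding \<phi>_def[abs_def] \<phi>d_def using m
  by (auto intro!: derivative_eq_intros simp: power2_eq_square field_simps)

lemma deriv_\<phi>d: "(\<phi>d has_real_derivative m^2 * \<phi> x - 1) (at x)"
  unfolding \<phi>d_def[abs_def] \<phi>_def using m
  by (auto intro!: derivative_eq_intros simp: power2_eq_square field_simps)

lemma deriv_\<psi>: "(\<psi> has_real_derivative (L - 2 * x) / 2) (at x)"
  unfolding \<psi>_def[abs_def] by (auto intro!: derivative_eq_intros simp: field_simps)

lemma deriv_\<theta>: "(\<theta> has_real_derivative \<theta>d x) (at x)"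
  unfolding \<theta>_def[abs_def] \<theta>d_def
  by (intro DERIV_cdivide DERIV_diff deriv_\<phi> deriv_\<psi>)

lemma deriv_\<theta>d: "(\<theta>d has_real_derivative - \<phi> x) (at x)"
  unfolding \<theta>d_def[abs_def] using m
  by (auto intro!: derivative_eq_intros deriv_\<phi>d simp: field_simps)

lemma cont: "continuous_on A \<phi>" "continuous_on A \<psi>" "continuous_on A \<theta>" "continuous_on A \<phi>d"
  "continuous_on A \<theta>d"
  by (meson DERIV_continuous_on has_field_derivative_at_within deriv_\<phi> deriv_\<psi> deriv_\<theta> deriv_\<phi>d deriv_\<theta>d)+

text \<open>The problem solved by \<open>\<phi>\<close> is invariant under reflection in the
  midpoint. The identity supplies the boundary value at \<open>L\<close> and turns each bound at the
  left end into its mirror image.\<close>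

lemma \<phi>_symmetric: "\<phi> (L - x) = \<phi> x"
proof -
  have "m * (L - x) = m * L - m * x" by (simp add: algebra_simps)
  then have e: "sinh (m * (L - x)) = sinh (m * L) * cosh (m * x) - cosh (m * L) * sinh (m * x)"
    "cosh (m * (L - x)) = cosh (m * L) * cosh (m * x) - sinh (m * L) * sinh (m * x)"
    by (simp_all only: sinh_diff cosh_diff)
  have "\<tau> * sinh (m * (L - x)) = (\<tau> * sinh (m * L)) * cosh (m * x) - (\<tau> * cosh (m * L)) * sinh (m * x)"
    unfolding e by (simp add: algebra_simps)
  then have "\<tau> * sinh (m * (L - x)) - cosh (m * (L - x)) = \<tau> * sinh (m * x) - cosh (m * x)"
    unfolding \<tau>_sinh \<tau>_cosh e(2) by (simp add: algebra_simps)
  then show ?thesis by (simp add: \<phi>_def)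
qed

lemma \<theta>_symmetric: "\<theta> (L - x) = \<theta> x"
  by (simp add: \<theta>_def \<phi>_symmetric \<psi>_def algebra_simps)

lemma boundary: "\<phi> 0 = 0" "\<phi> L = 0" "\<psi> 0 = 0" "\<psi> L = 0" "\<theta> 0 = 0" "\<theta> L = 0"
  using \<phi>_symmetric[of 0] by (auto simp: \<phi>_def \<psi>_def \<theta>_def)

lemma \<psi>_nonneg: "x \<in> {0..L} \<Longrightarrow> \<psi> x \<ge> 0"
  by (simp add: \<psi>_def)

lemma primitive_\<phi>d: "primitive_on 0 L \<phi>d (\<lambda>x. m^2 * \<phi> x - 1)"
  by (rule primitive_on_C1) (auto intro!: continuous_intros cont intro: has_field_derivative_at_within deriv_\<phi>d)

lemma primitive_\<theta>d: "primitive_on 0 L \<theta>d (\<lambda>x. - \<phi> x)"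
  by (rule primitive_on_C1) (auto intro!: continuous_intros cont intro: has_field_derivative_at_within deriv_\<theta>d)

lemma deriv_sinh: "((\<lambda>x. sinh (m * x)) has_real_derivative m * cosh (m * x)) (at x)"
  by (auto intro!: derivative_eq_intros)

lemma deriv_cosh: "((\<lambda>x. m * cosh (m * x)) has_real_derivative m^2 * sinh (m * x)) (at x)"
  by (auto intro!: derivative_eq_intros simp: power2_eq_square)

lemma sinh_wronskian:
  "sinh (m * (L - x)) * (m * cosh (m * x)) + sinh (m * x) * (m * cosh (m * (L - x))) = m * sinh (m * L)"
proof -
  have "sinh (m * (L - x) + m * x) = sinh (m * (L - x)) * cosh (m * x) + cosh (m * (L - x)) * sinh (m * x)"
    by (rule sinh_add)
  then show ?thesis by (simp add: algebra_simps)
qed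

lemma nonneg:
  assumes "x \<in> {0..L}"
    and "\<And>x. x \<in> {0..L} \<Longrightarrow> (v has_real_derivative v1 x) (at x within {0..L})"
    and "primitive_on 0 L v1 f" and "v 0 = 0" "v L = 0"
    and "negligible Z" "\<And>s. s \<in> {0..L} - Z \<Longrightarrow> 0 \<le> m^2 * v s - f s"
  shows "0 \<le> v x"
proof (rule green_nonneg[where L = L and v = v and ?v1.0 = v1 and f = f and Z = Z and
      \<kappa> = "m * sinh (m * L)" and S = "\<lambda>x. sinh (m * x)" and ?S1.0 = "\<lambda>x. m * cosh (m * x)" and M = "m^2"])
  show "0 < m * sinh (m * L)" using m mL_pos by simp
qed (use assms m in \<open>auto simp: deriv_sinh deriv_cosh sinh_wronskian\<close>)

lemma \<phi>_nonneg: "x \<in> {0..L} \<Longrightarrow> \<phi> x \<ge> 0"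
  by (rule nonneg[OF _ has_field_derivative_at_within[OF deriv_\<phi>] primitive_\<phi>d _ _ negligible_empty])
    (auto simp: boundary)

lemma \<theta>_nonneg: "x \<in> {0..L} \<Longrightarrow> \<theta> x \<ge> 0"
proof (rule nonneg[OF _ has_field_derivative_at_within[OF deriv_\<theta>] primitive_\<theta>d _ _ negligible_empty])
  fix s assume "s \<in> {0..L} - {}"
  moreover have "m^2 * \<theta> s - - \<phi> s = \<psi> s" using m by (simp add: \<theta>_def)
  ultimately show "0 \<le> m^2 * \<theta> s - - \<phi> s" using \<psi>_nonneg by simp
qed (auto simp: boundary)

text \<open>Dropping the term \<open>cosh - 1 \<ge> 0\<close>. The constant is sharp: the quotient
  of \<open>\<phi> x\<close> by \<open>sinh (m * x)\<close> tends to
  \<open>\<phi>'(0) / m = \<tau> / m^2\<close> at 0.\<close>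

lemma \<phi>_le: "m^2 * \<phi> x \<le> \<tau> * sinh (m * x)" "m^2 * \<phi> x \<le> \<tau> * sinh (m * (L - x))"
proof -
  have *: "m^2 * \<phi> x \<le> \<tau> * sinh (m * x)" for x
    using m cosh_real_ge_1[of "m * x"] by (simp add: \<phi>_def)
  show "m^2 * \<phi> x \<le> \<tau> * sinh (m * x)" by (rule *)
  show "m^2 * \<phi> x \<le> \<tau> * sinh (m * (L - x))" using *[of "L - x"] by (simp add: \<phi>_symmetric)
qed

lemma \<theta>1_pos: "\<theta>1 > 0"
proof -
  have "\<tau> * sinh (m * L) < m * L / 2 * sinh (m * L)"
    unfolding \<tau>_sinh using half_mult_sinh_gt_cosh[OF mL_pos(1)] by simp
  then have "\<tau> < m * L / 2" using mL_pos(2) by simp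
  then have "\<tau> / m < L / 2" using m by (simp add: field_simps)
  then show ?thesis using m by (simp add: \<theta>1_def)
qed

text \<open>Again the constant is the limit at the endpoint, since the quotient of
  \<open>\<theta> x\<close> by \<open>sinh (m * x)\<close> tends to \<open>\<theta>'(0) / m\<close>.
  Multiplying this bound with the one for \<open>\<phi>\<close> gives the rank-one estimate of the
  Green kernel.\<close>

lemma \<theta>_le:
  assumes "x \<in> {0..L}"
  shows "m * \<theta> x \<le> \<theta>1 * sinh (m * x)" "m * \<theta> x \<le> \<theta>1 * sinh (m * (L - x))"
proof -
  have *: "m * \<theta> x \<le> \<theta>1 * sinh (m * x)" if x: "x \<in> {0..L}" for x
  proof -
    define y where "y = m * x"
    define t where "t = m * L"
    have y: "0 \<le> y" "y \<le> t" using x m by (auto simp: y_def t_def)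
    \<comment> \<open>Split \<open>t * sinh y / 2\<close> into a part with factor \<open>y\<close>,
      which dominates \<open>cosh y - 1\<close>, and a part with factor \<open>t - y\<close>, where
      \<open>sinh y \<ge> y\<close> suffices.\<close>
    have "cosh y - 1 \<le> y * sinh y / 2"
      using half_mult_sinh_gt_cosh[of y] y by (cases "y = 0") auto
    moreover have "0 \<le> (t - y) * (sinh y - y)" using y sinh_ge_self[of y] by simp
    ultimately have "t * y / 2 - y^2 / 2 + (cosh y - 1) \<le> t * sinh y / 2"
      by (simp add: field_simps power2_eq_square)
    moreover have "m^2 * \<psi> x = t * y / 2 - y^2 / 2"
      by (simp add: \<psi>_def t_def y_def field_simps power2_eq_square)
    moreover have "m^2 * \<phi> x = \<tau> * sinh y - (cosh y - 1)"
      using m by (simp add: \<phi>_def y_def)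
    ultimately have "m^2 * (\<psi> x - \<phi> x) \<le> (t / 2 - \<tau>) * sinh y"
      by (simp add: algebra_simps)
    moreover have "m^2 * (\<psi> x - \<phi> x) = m^3 * (m * \<theta> x)" "(t / 2 - \<tau>) * sinh y = m^3 * (\<theta>1 * sinh y)"
      using m by (simp_all add: \<theta>_def \<theta>1_def t_def field_simps power2_eq_square power3_eq_cube)
    ultimately have "m^3 * (m * \<theta> x) \<le> m^3 * (\<theta>1 * sinh y)" by linarith
    then show ?thesis using m by (simp only: y_def[symmetric] mult_le_cancel_left_pos zero_less_power)
  qed
  show "m * \<theta> x \<le> \<theta>1 * sinh (m * x)" using * assms by blast
  show "m * \<theta> x \<le> \<theta>1 * sinh (m * (L - x))" using *[of "L - x"] assms by (simp add: \<theta>_symmetric)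
qed

lemma integral_\<theta>: "integral {0..L} \<theta> = ((m * L)^3 / 12 - m * L + 2 * \<tau>) / m^5"
proof -
  define A where "A x = ((L * x^2 / 4 - x^3 / 6) - (\<tau> * cosh (m * x) / m - sinh (m * x) / m + x) / m^2) / m^2" for x
  have "(\<theta> has_integral A L - A 0) {0..L}"
  proof (rule fundamental_theorem_of_calculus)
    show "(A has_vector_derivative \<theta> x) (at x within {0..L})" for x
      unfolding has_real_derivative_iff_has_vector_derivative[symmetric] A_def[abs_def] \<theta>_def \<phi>_def \<psi>_def
      using m by (auto intro!: derivative_eq_intros simp: field_simps power2_eq_square)
  qed (use L in simp)
  then have "integral {0..L} \<theta> = A L - A 0" by (rule integral_unique)
  also have "\<dots> = (L^3 / 12 - (\<tau> * cosh (m * L) - \<tau> - sinh (m * L) + m * L) / m^3) / m^2"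
    using m by (simp add: A_def field_simps power2_eq_square power3_eq_cube)
  also have "\<tau> * cosh (m * L) - \<tau> - sinh (m * L) + m * L = m * L - 2 * \<tau>"
    unfolding \<tau>_cosh by simp
  also have "(L^3 / 12 - (m * L - 2 * \<tau>) / m^3) / m^2 = ((m * L)^3 / 12 - m * L + 2 * \<tau>) / m^5"
    using m by (simp add: field_simps power2_eq_square power3_eq_cube eval_nat_numeral)
  finally show ?thesis .
qed

text \<open>With C = \<open>m^2 / (\<tau> * \<theta>1 * sinh (m * L))\<close> and K the integral of
  \<open>\<theta>\<close>, the claim reads \<open>N \<le> C * (1 + N * K)\<close>. Put
  \<open>t = m * L\<close>: in the difference of \<open>m^3 * \<tau> * \<theta>1 * sinh t\<close>
  and \<open>m^5 * K\<close> the terms with \<open>\<tau>\<close> cancel and one twelfth of the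
  denominator of \<open>sigma t\<close> remains. This is the origin of the formula for
  \<open>sigma\<close>.\<close>

lemma sigma_condition:
  assumes N: "N > 0" "N \<le> 4 * m^2 / L^3 * sigma (m * L)"
  shows "N * (\<tau> * \<theta>1 * sinh (m * L)) \<le> m^2 * (1 + N * integral {0..L} \<theta>)"
proof -
  define t where "t = m * L"
  define D where "D = 6 * t * cosh t + 6 * t - 12 * sinh t - t^3"
  have L': "L = t / m" using m by (simp add: t_def)
  have "4 * m^2 / L^3 * sigma t = 12 * m^5 / D"
  proof -
    have "sigma t = 3 * t^3 / D" by (simp add: sigma_def D_def)
    then show ?thesis using m mL_pos(1) by (simp add: L' t_def[symmetric] power_divide eval_nat_numeral)
  qed
  then have le: "N \<le> 12 * m^5 / D" using N by (simp add: t_def)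
  \<comment> \<open>The sign of \<open>D\<close> is read off the hypothesis: \<open>N > 0\<close> as
    a lower bound for the quotient excludes \<open>D \<le> 0\<close>, including
    \<open>D = 0\<close>, where division returns 0.\<close>
  with N have "12 * m^5 / D > 0" by simp
  then have "D > 0" using m by (simp add: zero_less_divide_iff)
  then have ND: "N * D \<le> 12 * m^5" using le by (simp add: field_simps)
  have \<tau>t: "\<tau> * sinh t = cosh t - 1" "\<tau> * cosh t = sinh t - \<tau>"
    using \<tau>_sinh \<tau>_cosh by (simp_all add: t_def)
  have th: "\<theta>1 = (t / 2 - \<tau>) / m^3"
    using m by (simp add: \<theta>1_def t_def field_simps eval_nat_numeral)
  have "\<tau> * \<theta>1 * sinh t = (\<tau> * sinh t) * (t / 2 - \<tau>) / m^3" unfolding th by simp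
  also have "(\<tau> * sinh t) * (t / 2 - \<tau>) = cosh t * t / 2 - \<tau> * cosh t - t / 2 + \<tau>"
    unfolding \<tau>t(1) by (simp add: field_simps)
  also have "(cosh t * t / 2 - \<tau> * cosh t - t / 2 + \<tau>) / m^3 = (cosh t * t / 2 - sinh t - t / 2 + 2 * \<tau>) / m^3"
    unfolding \<tau>t(2) by simp
  finally have 1: "\<tau> * \<theta>1 * sinh t = (cosh t * t / 2 - sinh t - t / 2 + 2 * \<tau>) / m^3" .
  have 2: "m^2 * (1 + N * integral {0..L} \<theta>) = (m^5 + N * (t^3 / 12 - t + 2 * \<tau>)) / m^3"
    unfolding integral_\<theta> t_def[symmetric] using m by (simp add: field_simps eval_nat_numeral)
  have "N * (cosh t * t / 2 - sinh t - t / 2 + 2 * \<tau>) \<le> m^5 + N * (t^3 / 12 - t + 2 * \<tau>)"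
    using ND by (simp add: D_def algebra_simps)
  then show ?thesis
    unfolding t_def[symmetric] 1 2 using m by (simp add: divide_right_mono)
qed

text \<open>The Green function of \<open>M u - u''\<close> satisfies \<open>G(x,s) \<ge> C \<phi>(x) \<theta>(s)\<close>, where \<open>C\<close> is the limit of the
  quotient at the corner \<open>x = 0\<close>, \<open>s = L\<close>. The bound on \<open>N\<close> by \<open>sigma\<close> says precisely that
  this dominates the nonlocal term.\<close>

lemma nonlocal_nonneg:
  assumes N: "N > 0" "N \<le> 4 * m^2 / L^3 * sigma (m * L)" and x: "x \<in> {0..L}"
    and w: "\<And>x. x \<in> {0..L} \<Longrightarrow> (w has_real_derivative w1 x) (at x within {0..L})"
    and w1: "\<And>x. x \<in> {0..L} \<Longrightarrow> (w1 has_real_derivative - v x) (at x within {0..L})"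
    and v: "\<And>x. x \<in> {0..L} \<Longrightarrow> (v has_real_derivative v1 x) (at x within {0..L})"
    and v1: "primitive_on 0 L v1 f" and bd: "w 0 = 0" "w L = 0" "v 0 = 0" "v L = 0"
    and Z: "negligible Z"
    and ae: "\<And>s. s \<in> {0..L} - Z \<Longrightarrow> 0 \<le> m^2 * v s - f s + N * integral {0..L} w"
  shows "0 \<le> v x"
proof -
  define W where "W = integral {0..L} w"
  define K where "K = integral {0..L} \<theta>"
  \<comment> \<open>Since \<open>m^2 * \<phi> - \<phi>'' = 1\<close>, this shift absorbs the
    nonlocal constant: \<open>h\<close>, the value of \<open>m^2 * u - u''\<close>, is nonnegative
    almost everywhere, and the goal becomes \<open>N * W * \<phi> x \<le> u x\<close>.\<close>
  define u where "u s = v s + N * W * \<phi> s" for s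
  define u1 where "u1 s = v1 s + N * W * \<phi>d s" for s
  define g where "g s = f s + N * W * (m^2 * \<phi> s - 1)" for s
  define h where "h s = m^2 * u s - g s" for s
  have h: "h s = m^2 * v s - f s + N * W" for s
    by (simp add: h_def u_def g_def algebra_simps)
  have h_nonneg: "0 \<le> h s" if "s \<in> {0..L} - Z" for s
    using ae[OF that] by (simp add: h W_def)
  have vc: "continuous_on {0..L} v" by (rule DERIV_continuous_on[OF v])
  have u: "(u has_real_derivative u1 s) (at s within {0..L})" if "s \<in> {0..L}" for s
    unfolding u_def[abs_def] u1_def
    by (intro DERIV_add DERIV_cmult v that has_field_derivative_at_within[OF deriv_\<phi>])
  have u1: "primitive_on 0 L u1 g"
    using primitive_on_lincomb[OF v1 primitive_\<phi>d, of 1 "N * W"]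
    by (simp add: u1_def[abs_def] g_def[abs_def])
  have ubd: "u 0 = 0" "u L = 0" by (simp_all add: u_def bd boundary)
  have uc: "continuous_on {0..L} u" by (rule DERIV_continuous_on[OF u])
  have h_int: "h absolutely_integrable_on {0..L}"
    unfolding h_def
    by (rule set_integral_diff(1)[OF absolutely_integrable_continuous_real primitive_on_integrable[OF u1]])
      (intro continuous_intros uc)

  \<comment> \<open>Green's identity with coefficient 0 and \<open>- \<psi>'' = 1\<close> recovers
    the integral of \<open>w\<close> from \<open>v = - w''\<close>.\<close>
  have "integral {0..L} (\<lambda>s. \<psi> s * (0 * w s - - v s)) =
      ((L - 2 * L) / 2 * w L - \<psi> L * w1 L) - ((L - 2 * 0) / 2 * w 0 - \<psi> 0 * w1 0)
      + integral {0..L} (\<lambda>s. (0 * \<psi> s - - 1) * w s)"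
  proof (rule green_identity)
    show "primitive_on 0 L w1 (\<lambda>s. - v s)"
      using w1 by (intro primitive_on_C1 continuous_intros vc)
    show "((\<lambda>x. (L - 2 * x) / 2) has_real_derivative - 1) (at x)" for x
      by (auto intro!: derivative_eq_intros)
  qed (use L w deriv_\<psi> in auto)
  then have \<psi>v: "integral {0..L} (\<lambda>s. \<psi> s * v s) = W"
    by (simp add: bd boundary W_def)
  \<comment> \<open>As \<open>m^2 * \<theta> - \<theta>'' = \<psi>\<close>, testing with
    \<open>\<theta>\<close> turns the operator on \<open>y\<close> into the moment of
    \<open>y\<close> against \<open>\<psi>\<close>. For \<open>y = \<phi>\<close> this identifies
    \<open>K\<close>; for \<open>y = u\<close> it determines \<open>W\<close> from
    \<open>h\<close>.\<close>
  have \<theta>_test: "integral {0..L} (\<lambda>s. \<theta> s * (m^2 * y s - z s)) = integral {0..L} (\<lambda>s. \<psi> s * y s)"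
    if "\<And>x. x \<in> {0..L} \<Longrightarrow> (y has_real_derivative y1 x) (at x within {0..L})"
      "primitive_on 0 L y1 z" "y 0 = 0" "y L = 0" for y y1 z
  proof -
    have "integral {0..L} (\<lambda>s. \<theta> s * (m^2 * y s - z s)) =
      (\<theta>d L * y L - \<theta> L * y1 L) - (\<theta>d 0 * y 0 - \<theta> 0 * y1 0)
      + integral {0..L} (\<lambda>s. (m^2 * \<theta> s - - \<phi> s) * y s)"
      using L that deriv_\<theta> deriv_\<theta>d
      by (intro green_identity) (auto intro!: continuous_intros cont)
    moreover have "m^2 * \<theta> s - - \<phi> s = \<psi> s" for s
      using m by (simp add: \<theta>_def)
    ultimately show ?thesis using that by (simp add: boundary)
  qed
  have K: "integral {0..L} (\<lambda>s. \<psi> s * \<phi> s) = K"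
    using \<theta>_test[OF has_field_derivative_at_within[OF deriv_\<phi>] primitive_\<phi>d] boundary by (simp add: K_def)
  have "integral {0..L} (\<lambda>s. \<theta> s * h s) = integral {0..L} (\<lambda>s. \<psi> s * u s)"
    unfolding h_def by (rule \<theta>_test[OF u u1 ubd])
  also have "\<dots> = integral {0..L} (\<lambda>s. \<psi> s * v s + N * W * (\<psi> s * \<phi> s))"
    by (simp add: u_def algebra_simps)
  also have "\<dots> = integral {0..L} (\<lambda>s. \<psi> s * v s) + integral {0..L} (\<lambda>s. N * W * (\<psi> s * \<phi> s))"
    by (intro integral_add integrable_continuous_real continuous_intros cont vc)
  finally have \<theta>h: "integral {0..L} (\<lambda>s. \<theta> s * h s) = W * (1 + N * K)"
    using \<psi>v K by (simp add: algebra_simps)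

  have "0 \<le> integral {0..L} (\<lambda>s. \<theta> s * h s)"
    using h_nonneg \<theta>_nonneg by (intro integral_nonneg_ae[OF Z]) auto
  moreover have "0 \<le> K"
    unfolding K_def using \<theta>_nonneg by (intro integral_nonneg integrable_continuous_real cont)
  then have "0 < 1 + N * K" using N(1) by (simp add: add_pos_nonneg)
  ultimately have W: "0 \<le> W"
    unfolding \<theta>h by (simp add: zero_le_mult_iff)

  define I1 where "I1 = integral {0..x} (\<lambda>s. sinh (m * s) * h s)"
  define I2 where "I2 = integral {x..L} (\<lambda>s. sinh (m * (L - s)) * h s)"
  define T1 where "T1 = integral {0..x} (\<lambda>s. \<theta> s * h s)"
  define T2 where "T2 = integral {x..L} (\<lambda>s. \<theta> s * h s)"
  have rep: "m * sinh (m * L) * u x = sinh (m * (L - x)) * I1 + sinh (m * x) * I2"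
    unfolding I1_def I2_def h_def
    by (rule green_representation[where S = "\<lambda>x. sinh (m * x)" and ?S1.0 = "\<lambda>x. m * cosh (m * x)",
        OF x u u1 ubd deriv_sinh _ deriv_cosh sinh_wronskian]) auto
  have int: "(\<lambda>s. k s * h s) integrable_on {a..b}"
    if "continuous_on {0..L} k" "0 \<le> a" "b \<le> L" for k a b
    using continuous_mult_absolutely_integrable[OF that(1) h_int] that
    by (auto simp: absolutely_integrable_on_def intro: integrable_subinterval_real)
  have T: "T1 + T2 = W * (1 + N * K)"
    unfolding T1_def T2_def \<theta>h[symmetric] using x
    by (intro Henstock_Kurzweil_Integration.integral_combine int cont) auto
  have Tnonneg: "0 \<le> T1" "0 \<le> T2"
    unfolding T1_def T2_def using h_nonneg \<theta>_nonneg x by (auto intro!: integral_nonneg_ae[OF Z])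
  have "m * T1 = integral {0..x} (\<lambda>s. (m * \<theta> s) * h s)" by (simp add: T1_def mult.assoc)
  also have "\<dots> \<le> integral {0..x} (\<lambda>s. (\<theta>1 * sinh (m * s)) * h s)"
    using x h_nonneg \<theta>_le
    by (intro integral_le_ae[OF Z] int mult_right_mono) (auto intro!: continuous_intros cont)
  also have "\<dots> = \<theta>1 * I1" by (simp add: I1_def mult.assoc)
  finally have I1: "m * T1 \<le> \<theta>1 * I1" .
  have "m * T2 = integral {x..L} (\<lambda>s. (m * \<theta> s) * h s)" by (simp add: T2_def mult.assoc)
  also have "\<dots> \<le> integral {x..L} (\<lambda>s. (\<theta>1 * sinh (m * (L - s))) * h s)"
    using x h_nonneg \<theta>_le
    by (intro integral_le_ae[OF Z] int mult_right_mono) (auto intro!: continuous_intros cont)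
  also have "\<dots> = \<theta>1 * I2" by (simp add: I2_def mult.assoc)
  finally have I2: "m * T2 \<le> \<theta>1 * I2" .

  \<comment> \<open>The kernel is a product on each side of the diagonal: for
    \<open>s \<le> x\<close> the bound for \<open>\<phi>\<close> at the right end meets the bound
    for \<open>\<theta>\<close> at the left end, and conversely for
    \<open>s \<ge> x\<close>.\<close>
  have \<phi>x: "0 \<le> m^2 * \<phi> x" using \<phi>_nonneg[OF x] by simp
  have "(m^2 * \<phi> x) * (m * T1) \<le> (\<tau> * sinh (m * (L - x))) * (\<theta>1 * I1)"
    using Tnonneg m by (intro mult_mono[OF \<phi>_le(2) I1 order_trans[OF \<phi>x \<phi>_le(2)]]) auto
  moreover have "(m^2 * \<phi> x) * (m * T2) \<le> (\<tau> * sinh (m * x)) * (\<theta>1 * I2)"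
    using Tnonneg m by (intro mult_mono[OF \<phi>_le(1) I2 order_trans[OF \<phi>x \<phi>_le(1)]]) auto
  ultimately have "(m^2 * \<phi> x) * (m * (T1 + T2)) \<le> \<tau> * \<theta>1 * (m * sinh (m * L) * u x)"
    unfolding rep by (simp add: algebra_simps)
  then have "m * (m^2 * \<phi> x * (T1 + T2)) \<le> m * (\<tau> * \<theta>1 * sinh (m * L) * u x)"
    by (simp add: algebra_simps)
  then have main: "m^2 * \<phi> x * (W * (1 + N * K)) \<le> \<tau> * \<theta>1 * sinh (m * L) * u x"
    unfolding T using m by (simp only: mult_le_cancel_left_pos)
  \<comment> \<open>The condition on \<open>N\<close> is multiplied by \<open>\<phi> x * W\<close>,
    so the sign of \<open>W\<close> found above is essential here.\<close>
  have "(\<phi> x * W) * (N * (\<tau> * \<theta>1 * sinh (m * L))) \<le> (\<phi> x * W) * (m^2 * (1 + N * K))"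
    using sigma_condition[OF N] \<phi>_nonneg[OF x] W unfolding K_def by (intro mult_left_mono) auto
  with main have "(\<tau> * \<theta>1 * sinh (m * L)) * (N * W * \<phi> x) \<le> (\<tau> * \<theta>1 * sinh (m * L)) * u x"
    by (simp add: algebra_simps)
  moreover have "0 < \<tau> * \<theta>1 * sinh (m * L)" using \<tau>_pos \<theta>1_pos mL_pos by simp
  ultimately have "N * W * \<phi> x \<le> u x" by (simp only: mult_le_cancel_left_pos)
  then show ?thesis by (simp add: u_def)
qed

end

section \<open>The linear boundary value problem\<close>

text \<open>For \<open>L > 0\<close> every point of the interval is a limit point of it, so the
  derivative within the interval is unique, one-sided at the ends, and the choice in
  \<open>der\<close> has a single candidate.\<close>

lemma der_eq:
  assumes "L > 0" "x \<in> {0..L}" "(f has_real_derivative D) (at x within {0..L})"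
  shows "der L f x = D"
  unfolding der_def
proof (rule some_equality)
  show "(f has_real_derivative D) (at x within {0..L})" by (rule assms(3))
next
  fix D' assume "(f has_real_derivative D') (at x within {0..L})"
  then show "D' = D"
    using assms vector_derivative_unique_within_closed_interval[of 0 L x f D' D]
    by (simp add: has_real_derivative_iff_has_vector_derivative)
qed

lemma der_cong:
  assumes "x \<in> {0..L}" "\<And>x. x \<in> {0..L} \<Longrightarrow> f x = g x"
  shows "der L f x = der L g x"
proof -
  have "(f has_real_derivative D) (at x within {0..L}) \<longleftrightarrow> (g has_real_derivative D) (at x within {0..L})" for D
    using assms has_field_derivative_transform_within[of _ D x "{0..L}" 1] by (metis zero_less_one)
  then show ?thesis by (simp add: der_def)
qed

lemma der_has_derivative:
  assumes "f differentiable (at x within {0..L})"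
  shows "(f has_real_derivative der L f x) (at x within {0..L})"
  using assms unfolding der_def real_differentiable_def by (rule someI_ex)

lemma D2_der: "D2 L w = der L (der L w)"
  by (simp add: numeral_2_eq_2)

lemma D4_der: "D4 L w = der L (der L (D2 L w))"
  by (simp add: eval_nat_numeral)

lemma D3_der: "(der L ^^ 3) w = der L (D2 L w)"
  by (simp add: eval_nat_numeral)

lemma all_less_2_3:
  "(\<forall>k<2. P k) \<longleftrightarrow> P 0 \<and> P (1::nat)"
  "(\<forall>k<3. P k) \<longleftrightarrow> P 0 \<and> P (1::nat) \<and> P 2"
  by (auto simp: less_Suc_eq numeral_2_eq_2 numeral_3_eq_3)

lemma C2_derivatives:
  assumes "C2 L u"
  shows "\<And>x. x \<in> {0..L} \<Longrightarrow> (u has_real_derivative der L u x) (at x within {0..L})"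
    "\<And>x. x \<in> {0..L} \<Longrightarrow> (der L u has_real_derivative D2 L u x) (at x within {0..L})"
    "continuous_on {0..L} (D2 L u)" "continuous_on {0..L} u"
proof -
  show 1: "\<And>x. x \<in> {0..L} \<Longrightarrow> (u has_real_derivative der L u x) (at x within {0..L})"
    using assms by (auto simp: C2_def all_less_2_3 intro: der_has_derivative)
  show "\<And>x. x \<in> {0..L} \<Longrightarrow> (der L u has_real_derivative D2 L u x) (at x within {0..L})"
    using assms by (auto simp: C2_def all_less_2_3 D2_der intro: der_has_derivative)
  show "continuous_on {0..L} (D2 L u)" using assms by (simp add: C2_def)
  show "continuous_on {0..L} u" by (rule DERIV_continuous_on[OF 1])
qed

lemma C2_I:
  assumes L: "L > 0"
    and u: "\<And>x. x \<in> {0..L} \<Longrightarrow> (u has_real_derivative u1 x) (at x within {0..L})"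
    and u1: "\<And>x. x \<in> {0..L} \<Longrightarrow> (u1 has_real_derivative u2 x) (at x within {0..L})"
    and u2: "continuous_on {0..L} u2"
  shows "C2 L u" "\<And>x. x \<in> {0..L} \<Longrightarrow> D2 L u x = u2 x"
proof -
  have d1: "der L u x = u1 x" if "x \<in> {0..L}" for x
    using der_eq[OF L that u[OF that]] .
  have d1': "(der L u has_real_derivative u2 x) (at x within {0..L})" if "x \<in> {0..L}" for x
    using has_field_derivative_transform_within[OF u1[OF that], of 1] that d1 by simp
  show d2: "D2 L u x = u2 x" if "x \<in> {0..L}" for x
    unfolding D2_der using der_eq[OF L that d1'[OF that]] .
  show "C2 L u"
    unfolding C2_def all_less_2_3
  proof (intro conjI ballI)
    fix x assume x: "x \<in> {0..L}"
    show "(der L ^^ 0) u differentiable at x within {0..L}"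
      using u[OF x] by (auto simp: real_differentiable_def)
    show "(der L ^^ 1) u differentiable at x within {0..L}"
      using d1'[OF x] by (auto simp: real_differentiable_def)
  next
    show "continuous_on {0..L} (D2 L u)"
      using d2 by (intro continuous_on_eq[OF u2]) simp
  qed
qed

lemma W41_C2: "W41 L w \<Longrightarrow> C2 L w"
  unfolding W41_def C2_def all_less_2_3
  by (auto simp: continuous_on_eq_continuous_within intro: differentiable_imp_continuous_within)

text \<open>Off a null set Lebesgue's theorem evaluates \<open>D4 L w\<close> to the density
  \<open>g\<close> of the third derivative. On the null set the choice in \<open>der\<close> may
  return anything, which neither integrability nor integrals can see.\<close>

lemma W41_derivatives:
  assumes L: "L > 0" and w: "W41 L w"
  shows "\<And>x. x \<in> {0..L} \<Longrightarrow> (D2 L w has_real_derivative der L (D2 L w) x) (at x within {0..L})"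
    "primitive_on 0 L (der L (D2 L w)) (D4 L w)"
proof -
  show "\<And>x. x \<in> {0..L} \<Longrightarrow> (D2 L w has_real_derivative der L (D2 L w) x) (at x within {0..L})"
    using w by (auto simp: W41_def all_less_2_3 intro: der_has_derivative)
  let ?w3 = "der L (D2 L w)"
  obtain g where g: "g absolutely_integrable_on {0..L}"
    "\<And>x. x \<in> {0..L} \<Longrightarrow> ?w3 x = ?w3 0 + integral {0..x} g"
    using w unfolding W41_def D3_der by blast
  obtain S where S: "negligible S" "\<And>x. x \<in> {0..L} - S \<Longrightarrow>
      ((\<lambda>x. integral {0..x} g) has_real_derivative g x) (at x within {0..L})"
    using indefinite_integral_has_derivative_ae[of g 0 L] g(1) by (auto simp: absolutely_integrable_on_def)
  have D4: "D4 L w x = g x" if x: "x \<in> {0..L} - S" for x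
  proof -
    have "((\<lambda>x. ?w3 0 + integral {0..x} g) has_real_derivative g x) (at x within {0..L})"
      using DERIV_add[OF DERIV_const S(2)[OF x], of "?w3 0"] by simp
    then have "der L (\<lambda>x. ?w3 0 + integral {0..x} g) x = g x"
      using der_eq[OF L] x by simp
    moreover have "der L ?w3 x = der L (\<lambda>x. ?w3 0 + integral {0..x} g) x"
      using x by (intro der_cong g(2)) auto
    ultimately show ?thesis unfolding D4_der by (rule trans[rotated])
  qed
  show "primitive_on 0 L ?w3 (D4 L w)"
    unfolding primitive_on_def
  proof
    show "D4 L w absolutely_integrable_on {0..L}"
      using absolutely_integrable_spike[OF g(1) S(1)] D4 by blast
    show "\<forall>x\<in>{0..L}. ?w3 x = ?w3 0 + integral {0..x} (D4 L w)"
    proof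
      fix x assume x: "x \<in> {0..L}"
      have "integral {0..x} g = integral {0..x} (D4 L w)"
        using D4 x by (intro integral_spike[OF S(1)]) auto
      then show "?w3 x = ?w3 0 + integral {0..x} (D4 L w)" using g(2)[OF x] by (rule subst)
    qed
  qed
qed

lemma W41_I:
  assumes L: "L > 0"
    and w: "\<And>x. x \<in> {0..L} \<Longrightarrow> (w has_real_derivative w1 x) (at x within {0..L})"
    and w1: "\<And>x. x \<in> {0..L} \<Longrightarrow> (w1 has_real_derivative w2 x) (at x within {0..L})"
    and w2: "\<And>x. x \<in> {0..L} \<Longrightarrow> (w2 has_real_derivative w3 x) (at x within {0..L})"
    and w3: "primitive_on 0 L w3 g"
  shows "W41 L w" "\<And>x. x \<in> {0..L} \<Longrightarrow> D2 L w x = w2 x" "ae_on L (\<lambda>x. D4 L w x = g x)"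
proof -
  have w2c: "continuous_on {0..L} w2" by (rule DERIV_continuous_on[OF w2])
  note C2 = C2_I[OF L w w1 w2c]
  show d2: "\<And>x. x \<in> {0..L} \<Longrightarrow> D2 L w x = w2 x" by (rule C2(2))
  have d2': "(D2 L w has_real_derivative w3 x) (at x within {0..L})" if "x \<in> {0..L}" for x
    using has_field_derivative_transform_within[OF w2[OF that], of 1] that d2 by simp
  have d3: "der L (D2 L w) x = w3 x" if "x \<in> {0..L}" for x
    using der_eq[OF L that d2'[OF that]] .
  show "W41 L w"
    unfolding W41_def D3_der all_less_2_3
  proof (intro conjI exI[of _ g] ballI)
    fix x assume x: "x \<in> {0..L}"
    show "(der L ^^ 0) w differentiable at x within {0..L}" "(der L ^^ 1) w differentiable at x within {0..L}"
      using C2(1) x by (auto simp: C2_def all_less_2_3)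
    show "D2 L w differentiable at x within {0..L}"
      using d2'[OF x] by (auto simp: real_differentiable_def)
    show "der L (D2 L w) x = der L (D2 L w) 0 + integral {0..x} g"
      unfolding d3[OF x] using d3[of 0] L primitive_on_integral[OF w3 x] by simp
  qed (rule primitive_on_integrable[OF w3])
  obtain S where S: "negligible S" "\<And>x. x \<in> {0..L} - S \<Longrightarrow>
      ((\<lambda>x. integral {0..x} g) has_real_derivative g x) (at x within {0..L})"
    using indefinite_integral_has_derivative_ae[of g 0 L] primitive_on_integrable[OF w3]
    by (auto simp: absolutely_integrable_on_def)
  have "D4 L w x = g x" if x: "x \<in> {0..L} - S" for x
  proof -
    have "((\<lambda>x. w3 0 + integral {0..x} g) has_real_derivative g x) (at x within {0..L})"
      using DERIV_add[OF DERIV_const S(2)[OF x], of "w3 0"] by simp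
    then have "der L (\<lambda>x. w3 0 + integral {0..x} g) x = g x"
      using der_eq[OF L] x by simp
    moreover have "der L (der L (D2 L w)) x = der L (\<lambda>x. w3 0 + integral {0..x} g) x"
    proof (rule der_cong)
      fix y assume y: "y \<in> {0..L}"
      show "der L (D2 L w) y = w3 0 + integral {0..y} g"
        unfolding d3[OF y] by (rule primitive_on_integral[OF w3 y])
    qed (use x in auto)
    ultimately show ?thesis unfolding D4_der by (rule trans[rotated])
  qed
  then show "ae_on L (\<lambda>x. D4 L w x = g x)" using S(1) by (auto simp: ae_on_def)
qed

lemma ae_on_mono:
  "ae_on L P \<Longrightarrow> (\<And>x. x \<in> {0..L} \<Longrightarrow> P x \<Longrightarrow> Q x) \<Longrightarrow> ae_on L Q"
  unfolding ae_on_def by blast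

lemma ae_on_mono2:
  assumes "ae_on L P" "ae_on L Q" "\<And>x. x \<in> {0..L} \<Longrightarrow> P x \<Longrightarrow> Q x \<Longrightarrow> R x"
  shows "ae_on L R"
proof -
  obtain S T where "negligible S" "negligible T" "\<forall>x\<in>{0..L} - S. P x" "\<forall>x\<in>{0..L} - T. Q x"
    using assms by (auto simp: ae_on_def)
  then show ?thesis
    unfolding ae_on_def using assms(3) by (intro exI[of _ "S \<union> T"]) auto
qed

section \<open>Comparison principle for the linear operator\<close>

text \<open>Applied to the difference \<open>z = w - u\<close>, the kernel estimate settles the sign
  of the second derivative; the order of the functions then follows from concavity and zero boundary
  values.\<close>

lemma linear_comparison:
  assumes L: "L > 0" and M: "M > 0" and N: "N > 0" "N \<le> 4 * M / L ^ 3 * sigma (sqrt M * L)"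
    and u: "W41 L u" "bc L u" and w: "W41 L w" "bc L w"
    and ae: "ae_on L (\<lambda>x. D4 L u x - M * D2 L u x + N * integral {0..L} u
                       \<le> D4 L w x - M * D2 L w x + N * integral {0..L} w)"
    and x: "x \<in> {0..L}"
  shows "u x \<le> w x" "D2 L w x \<le> D2 L u x"
proof -
  interpret beam_kernel L "sqrt M" by unfold_locales (use L M in auto)
  note du = C2_derivatives[OF W41_C2[OF u(1)]] and dw = C2_derivatives[OF W41_C2[OF w(1)]]
  note du' = W41_derivatives[OF L u(1)] and dw' = W41_derivatives[OF L w(1)]
  define z where "z x = w x - u x" for x
  define z1 where "z1 x = der L w x - der L u x" for x
  define v where "v x = D2 L u x - D2 L w x" for x
  have z: "(z has_real_derivative z1 x) (at x within {0..L})" if "x \<in> {0..L}" for x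
    unfolding z_def[abs_def] z1_def using du dw that by (intro DERIV_diff)
  have z1: "(z1 has_real_derivative - v x) (at x within {0..L})" if "x \<in> {0..L}" for x
    unfolding z1_def[abs_def] v_def using DERIV_diff[OF dw(2)[OF that] du(2)[OF that]] by simp
  have bd: "z 0 = 0" "z L = 0" "v 0 = 0" "v L = 0"
    using u(2) w(2) by (auto simp: bc_def z_def v_def)
  have Iz: "integral {0..L} z = integral {0..L} w - integral {0..L} u"
    unfolding z_def by (intro integral_diff integrable_continuous_real du dw)
  obtain Z where Z: "negligible Z" "\<And>x. x \<in> {0..L} - Z \<Longrightarrow>
      D4 L u x - M * D2 L u x + N * integral {0..L} u \<le> D4 L w x - M * D2 L w x + N * integral {0..L} w"
    using ae unfolding ae_on_def by blast
  have v_nonneg: "0 \<le> v x" if x: "x \<in> {0..L}" for x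
  proof (rule nonlocal_nonneg[OF _ _ x z z1 _ _ bd Z(1)])
    show "N > 0" "N \<le> 4 * (sqrt M)\<^sup>2 / L ^ 3 * sigma (sqrt M * L)" using N M by auto
    show "(v has_real_derivative der L (D2 L u) x - der L (D2 L w) x) (at x within {0..L})"
      if "x \<in> {0..L}" for x
      unfolding v_def[abs_def] using du' dw' that by (intro DERIV_diff)
    show "primitive_on 0 L (\<lambda>x. der L (D2 L u) x - der L (D2 L w) x) (\<lambda>x. D4 L u x - D4 L w x)"
      using primitive_on_lincomb[OF du'(2) dw'(2), of 1 "-1"] by simp
    show "0 \<le> (sqrt M)\<^sup>2 * v s - (D4 L u s - D4 L w s) + N * integral {0..L} z" if "s \<in> {0..L} - Z" for s
      using Z(2)[OF that] M by (simp add: Iz v_def algebra_simps)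
  qed
  then show "D2 L w x \<le> D2 L u x" using x by (simp add: v_def)
  have vc: "continuous_on {0..L} v" unfolding v_def by (intro continuous_intros du dw)
  have "primitive_on 0 L z1 (\<lambda>x. - v x)"
    using z1 by (intro primitive_on_C1 continuous_intros vc)
  then have "0 \<le> z x"
    using v_nonneg by (intro concave_nonneg[OF x L z _ bd(1,2) negligible_empty]) auto
  then show "u x \<le> w x" by (simp add: z_def)
qed

section \<open>Solvability of the linear problem\<close>

lemma second_primitive:
  assumes L: "L > 0" and V: "continuous_on {0..L} V"
  obtains w w1 where
    "\<And>x. x \<in> {0..L} \<Longrightarrow> (w has_real_derivative w1 x) (at x within {0..L})"
    "\<And>x. x \<in> {0..L} \<Longrightarrow> (w1 has_real_derivative V x) (at x within {0..L})"
    "w 0 = 0" "w L = 0"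
proof -
  define A where "A x = integral {0..x} V" for x
  have A: "(A has_real_derivative V x) (at x within {0..L})" if "x \<in> {0..L}" for x
    unfolding A_def[abs_def] by (rule integral_has_real_derivative[OF V that])
  have Ac: "continuous_on {0..L} A" by (rule DERIV_continuous_on[OF A])
  define B where "B x = integral {0..x} A" for x
  have B: "(B has_real_derivative A x) (at x within {0..L})" if "x \<in> {0..L}" for x
    unfolding B_def[abs_def] by (rule integral_has_real_derivative[OF Ac that])
  \<comment> \<open>Subtracting \<open>c * x\<close> restores the zero at \<open>L\<close> without
    changing the second derivative.\<close>
  define c where "c = B L / L"
  show ?thesis
  proof (rule that[of "\<lambda>x. B x - c * x" "\<lambda>x. A x - c"])
    fix x assume x: "x \<in> {0..L}"
    show "((\<lambda>x. B x - c * x) has_real_derivative A x - c) (at x within {0..L})"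
      using B[OF x] by (auto intro!: derivative_eq_intros)
    show "((\<lambda>x. A x - c) has_real_derivative V x) (at x within {0..L})"
      using A[OF x] by (auto intro!: derivative_eq_intros)
  next
    show "B 0 - c * 0 = 0" by (simp add: B_def)
    show "B L - c * L = 0" using L by (simp add: c_def)
  qed
qed

text \<open>Writing \<open>H\<close> for the primitive of \<open>h\<close>, the equation \<open>M v - v'' = h\<close> is the system
  \<open>v' = z - H\<close>, \<open>z' = M v\<close> with continuous right-hand side, solved by variation of constants.\<close>

lemma (in beam_kernel) second_order_solution:
  assumes h: "h absolutely_integrable_on {0..L}"
  obtains v v1 where
    "\<And>x. x \<in> {0..L} \<Longrightarrow> (v has_real_derivative v1 x) (at x within {0..L})"
    "primitive_on 0 L v1 (\<lambda>x. m^2 * v x - h x)" "v 0 = 0" "v L = 0"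
proof -
  define H where "H x = integral {0..x} h" for x
  have H: "primitive_on 0 L H h" using h by (auto simp: primitive_on_def H_def)
  have Hc: "continuous_on {0..L} H" by (rule primitive_on_continuous[OF H])
  define P where "P x = integral {0..x} (\<lambda>s. cosh (m * s) * H s)" for x
  define Q where "Q x = integral {0..x} (\<lambda>s. sinh (m * s) * H s)" for x
  have P: "(P has_real_derivative cosh (m * x) * H x) (at x within {0..L})" if "x \<in> {0..L}" for x
    unfolding P_def[abs_def] by (rule integral_has_real_derivative[OF _ that]) (intro continuous_intros Hc)
  have Q: "(Q has_real_derivative sinh (m * x) * H x) (at x within {0..L})" if "x \<in> {0..L}" for x
    unfolding Q_def[abs_def] by (rule integral_has_real_derivative[OF _ that]) (intro continuous_intros Hc)
  \<comment> \<open>\<open>A\<close> is the free coefficient of the homogeneous solution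
    \<open>sinh (m * x)\<close>, determined by \<open>v L = 0\<close>; the value at 0 vanishes
    because \<open>P 0 = 0\<close>.\<close>
  define A where "A = (cosh (m * L) * P L - sinh (m * L) * Q L) / sinh (m * L)"
  define v where "v x = A * sinh (m * x) - cosh (m * x) * P x + sinh (m * x) * Q x" for x
  define z where "z x = m * (A * cosh (m * x) - sinh (m * x) * P x + cosh (m * x) * Q x)" for x
  have v: "(v has_real_derivative z x - H x) (at x within {0..L})" if x: "x \<in> {0..L}" for x
  proof -
    have "(v has_real_derivative A * (m * cosh (m * x))
        - (m * sinh (m * x) * P x + cosh (m * x) * (cosh (m * x) * H x))
        + (m * cosh (m * x) * Q x + sinh (m * x) * (sinh (m * x) * H x))) (at x within {0..L})"
      unfolding v_def[abs_def] using P[OF x] Q[OF x]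
      by (auto intro!: derivative_eq_intros simp: algebra_simps)
    moreover have "cosh (m * x) * (cosh (m * x) * H x) = H x + sinh (m * x) * (sinh (m * x) * H x)"
      using hyperbolic_pythagoras[of "m * x"] by algebra
    ultimately show ?thesis by (simp add: z_def algebra_simps)
  qed
  have vc: "continuous_on {0..L} v" by (rule DERIV_continuous_on[OF v])
  have z: "(z has_real_derivative m^2 * v x) (at x within {0..L})" if x: "x \<in> {0..L}" for x
    unfolding z_def[abs_def] v_def using P[OF x] Q[OF x]
    by (auto intro!: derivative_eq_intros simp: algebra_simps power2_eq_square)
  have "primitive_on 0 L z (\<lambda>x. m^2 * v x)"
    using z by (intro primitive_on_C1 continuous_intros vc)
  from primitive_on_lincomb[OF this H, of 1 "-1"]
  have v1: "primitive_on 0 L (\<lambda>x. z x - H x) (\<lambda>x. m^2 * v x - h x)" by simp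
  have "v 0 = 0" by (simp add: v_def P_def)
  moreover have "v L = 0" using L m by (simp add: v_def A_def)
  ultimately show ?thesis using that[of v "\<lambda>x. z x - H x"] v v1 by simp
qed

text \<open>\<open>w\<close> solves the local problem with right-hand side \<open>h\<close>, and
  \<open>k\<close> the local problem with right-hand side 1, since \<open>k'' = - \<phi>\<close>. In
  the ansatz \<open>y = w - N * W * k\<close> the number \<open>W\<close> must equal the integral of
  \<open>y\<close>, a scalar linear equation with coefficient \<open>1 + N * I\<close>, I the
  integral of \<open>k\<close>; concavity makes \<open>k \<ge> 0\<close>, so this coefficient is
  positive.\<close>

lemma linear_solution_exists:
  assumes L: "L > 0" and M: "M > 0" and N: "N \<ge> 0" and h: "h absolutely_integrable_on {0..L}"
  obtains w where "W41 L w" "bc L w"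
    "ae_on L (\<lambda>x. D4 L w x - M * D2 L w x + N * integral {0..L} w = h x)"
proof -
  interpret beam_kernel L "sqrt M" by unfold_locales (use L M in auto)
  obtain v v1 where v: "\<And>x. x \<in> {0..L} \<Longrightarrow> (v has_real_derivative v1 x) (at x within {0..L})"
    and v1: "primitive_on 0 L v1 (\<lambda>x. (sqrt M)^2 * v x - h x)" and vbd: "v 0 = 0" "v L = 0"
    using second_order_solution[OF h] by blast
  have vc: "continuous_on {0..L} (\<lambda>x. - v x)"
    by (intro continuous_intros DERIV_continuous_on[OF v])
  obtain w w1 where w: "\<And>x. x \<in> {0..L} \<Longrightarrow> (w has_real_derivative w1 x) (at x within {0..L})"
    "\<And>x. x \<in> {0..L} \<Longrightarrow> (w1 has_real_derivative - v x) (at x within {0..L})" "w 0 = 0" "w L = 0"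
    using second_primitive[OF L vc] by blast
  have \<phi>c: "continuous_on {0..L} (\<lambda>x. - \<phi> x)" by (intro continuous_intros cont)
  obtain k k1 where k: "\<And>x. x \<in> {0..L} \<Longrightarrow> (k has_real_derivative k1 x) (at x within {0..L})"
    "\<And>x. x \<in> {0..L} \<Longrightarrow> (k1 has_real_derivative - \<phi> x) (at x within {0..L})" "k 0 = 0" "k L = 0"
    using second_primitive[OF L \<phi>c] by blast
  have k1: "primitive_on 0 L k1 (\<lambda>x. - \<phi> x)" by (rule primitive_on_C1[OF k(2) \<phi>c])
  have "0 \<le> k x" if "x \<in> {0..L}" for x
    using \<phi>_nonneg by (intro concave_nonneg[OF that L k(1) k1 k(3,4) negligible_empty]) auto
  then have Ik: "0 \<le> integral {0..L} k"
    by (intro integral_nonneg integrable_continuous_real DERIV_continuous_on[OF k(1)])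
  define W where "W = integral {0..L} w / (1 + N * integral {0..L} k)"
  have pos: "1 + N * integral {0..L} k > 0" using Ik N by (simp add: add_pos_nonneg)
  define y where "y x = w x - N * W * k x" for x
  have "integral {0..L} y = integral {0..L} w - integral {0..L} (\<lambda>x. N * W * k x)"
    unfolding y_def
    by (intro integral_diff integrable_continuous_real continuous_intros DERIV_continuous_on[OF k(1)]
        DERIV_continuous_on[OF w(1)])
  also have "integral {0..L} w = W * (1 + N * integral {0..L} k)" using pos by (simp add: W_def)
  finally have Iy: "integral {0..L} y = W" by (simp add: algebra_simps)
  define g where "g x = h x - M * v x - N * W + N * W * M * \<phi> x" for x
  have y: "W41 L y" "\<And>x. x \<in> {0..L} \<Longrightarrow> D2 L y x = - v x + N * W * \<phi> x" "ae_on L (\<lambda>x. D4 L y x = g x)"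
  proof -
    have d: "(y has_real_derivative w1 x - N * W * k1 x) (at x within {0..L})"
      "((\<lambda>x. w1 x - N * W * k1 x) has_real_derivative - v x + N * W * \<phi> x) (at x within {0..L})"
      "((\<lambda>x. - v x + N * W * \<phi> x) has_real_derivative - v1 x + N * W * \<phi>d x) (at x within {0..L})"
      if "x \<in> {0..L}" for x
      unfolding y_def[abs_def]
      using w(1,2)[OF that] k(1,2)[OF that] v[OF that] has_field_derivative_at_within[OF deriv_\<phi>]
      by (auto intro!: derivative_eq_intros)
    have "primitive_on 0 L (\<lambda>x. - v1 x + N * W * \<phi>d x) g"
    proof -
      have "g = (\<lambda>x. (-1) * ((sqrt M)\<^sup>2 * v x - h x) + N * W * ((sqrt M)\<^sup>2 * \<phi> x - 1))"
        using M by (auto simp: g_def algebra_simps)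
      then show ?thesis
        using primitive_on_lincomb[OF v1 primitive_\<phi>d, of "-1" "N * W"] by simp
    qed
    note W41_I[OF L d this]
    then show "W41 L y" "\<And>x. x \<in> {0..L} \<Longrightarrow> D2 L y x = - v x + N * W * \<phi> x" "ae_on L (\<lambda>x. D4 L y x = g x)"
      by blast+
  qed
  show ?thesis
  proof (rule that[OF y(1)])
    show "bc L y"
      unfolding bc_def using y(2)[of 0] y(2)[of L] L by (simp add: y_def w k vbd boundary)
    show "ae_on L (\<lambda>x. D4 L y x - M * D2 L y x + N * integral {0..L} y = h x)"
      using y(3) by (rule ae_on_mono) (simp add: y(2) Iy g_def algebra_simps)
  qed
qed

section \<open>The monotone iteration\<close>

text \<open>The parabola \<open>C * x * (L - x) / 2\<close> has second derivative \<open>- C\<close>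
  and vanishes at both ends, so its difference to \<open>z - y\<close> is concave with zero boundary
  values. \<open>C\<close> may be the width of a gap, or 0 to deduce the order of functions from
  that of second derivatives.\<close>

lemma D2_diff_le_imp_diff_le:
  assumes L: "L > 0" and y: "C2 L y" "y 0 = 0" "y L = 0" and z: "C2 L z" "z 0 = 0" "z L = 0"
    and C: "\<And>x. x \<in> {0..L} \<Longrightarrow> D2 L y x - D2 L z x \<le> C" and x: "x \<in> {0..L}"
  shows "z x - y x \<le> C * (x * (L - x) / 2)"
proof -
  note dy = C2_derivatives[OF y(1)] and dz = C2_derivatives[OF z(1)]
  have "0 \<le> C * (x * (L - x) / 2) - (z x - y x)"
  proof (rule concave_nonneg[OF x L, where f = "\<lambda>x. - C - (D2 L z x - D2 L y x)" and Z = "{}"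
        and ?v1.0 = "\<lambda>x. C * ((L - 2 * x) / 2) - (der L z x - der L y x)"])
    have d: "((\<lambda>x. C * ((L - 2 * x) / 2) - (der L z x - der L y x)) has_real_derivative
        - C - (D2 L z x - D2 L y x)) (at x within {0..L})" if "x \<in> {0..L}" for x
      using dy(2)[OF that] dz(2)[OF that] by (auto intro!: derivative_eq_intros)
    show "primitive_on 0 L (\<lambda>x. C * ((L - 2 * x) / 2) - (der L z x - der L y x))
        (\<lambda>x. - C - (D2 L z x - D2 L y x))"
      by (rule primitive_on_C1[OF d]) (auto intro!: continuous_intros dy dz)
    fix s assume "s \<in> {0..L}"
    then show "((\<lambda>x. C * (x * (L - x) / 2) - (z x - y x)) has_real_derivative
        C * ((L - 2 * s) / 2) - (der L z s - der L y s)) (at s within {0..L})"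
      using dy(1) dz(1) by (auto intro!: derivative_eq_intros simp: field_simps)
  next
    fix s assume "s \<in> {0..L} - {}"
    then show "- C - (D2 L z s - D2 L y s) \<le> 0" using C[of s] by auto
  qed (use y z in auto)
  then show ?thesis by simp
qed

lemma mult_diff_le_square:
  fixes x L :: real
  shows "x * (L - x) / 2 \<le> L^2 / 8"
proof -
  have "0 \<le> (L - 2 * x)^2" by simp
  then show ?thesis by (simp add: power2_eq_square algebra_simps)
qed

section \<open>The order interval and the monotone right-hand side\<close>

locale beam_problem =
  fixes L a b c M N :: real and p \<alpha> \<beta> :: "real \<Rightarrow> real"
  assumes L: "L > 0" and b: "b > 0"
    and p: "p absolutely_integrable_on {0..L}"
    and M: "M > 0" and N: "N > 0" "N \<le> 4 * M / L ^ 3 * sigma (sqrt M * L)"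
    and lower: "is_lower L a b c p \<alpha>" and upper: "is_upper L a b c p \<beta>"
    and \<alpha>\<beta>: "\<And>x. x \<in> {0..L} \<Longrightarrow> \<alpha> x \<le> \<beta> x"
    and \<alpha>\<beta>2: "\<And>x. x \<in> {0..L} \<Longrightarrow> D2 L \<alpha> x \<le> 0 \<and> D2 L \<beta> x \<le> D2 L \<alpha> x"
    and M_bound: "a + b * integral {0..L} \<beta> \<le> M"
    and N_bound: "c - b * Inf (D2 L \<beta> ` {0..L}) \<le> N"
    and contraction: "a + b * integral {0..L} \<alpha> + L ^ 3 / 4 * c > L ^ 3 * N / 4 + M - 4 / L ^ 2"
begin

abbreviation I :: "(real \<Rightarrow> real) \<Rightarrow> real" where "I u \<equiv> integral {0..L} u"

definition le :: "(real \<Rightarrow> real) \<Rightarrow> (real \<Rightarrow> real) \<Rightarrow> bool" where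
  "le y z \<longleftrightarrow> (\<forall>x\<in>{0..L}. y x \<le> z x \<and> D2 L z x \<le> D2 L y x)"

definition rhs :: "(real \<Rightarrow> real) \<Rightarrow> real \<Rightarrow> real" where
  "rhs y x = p x + (a + b * I y) * D2 L y x - c * I y - M * D2 L y x + N * I y"

definition step :: "(real \<Rightarrow> real) \<Rightarrow> (real \<Rightarrow> real) \<Rightarrow> bool" where
  "step y z \<longleftrightarrow> W41 L z \<and> bc L z \<and>
     ae_on L (\<lambda>x. D4 L z x - M * D2 L z x + N * I z = rhs y x)"

lemma iter_seq_step: "iter_seq L a b c p M N y0 y \<longleftrightarrow> y 0 = y0 \<and> (\<forall>n. step (y n) (y (Suc n)))"
  by (simp add: iter_seq_def step_def rhs_def)

lemma ord_int_le: "u \<in> ord_int L \<alpha> \<beta> \<longleftrightarrow> C2 L u \<and> le \<alpha> u \<and> le u \<beta>"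
  by (auto simp: ord_int_def le_def)

lemma le_refl: "le y y" by (simp add: le_def)

lemma le_trans: "le x y \<Longrightarrow> le y z \<Longrightarrow> le x z"
  unfolding le_def by (meson order_trans)

lemma leD: "le y z \<Longrightarrow> x \<in> {0..L} \<Longrightarrow> y x \<le> z x" "le y z \<Longrightarrow> x \<in> {0..L} \<Longrightarrow> D2 L z x \<le> D2 L y x"
  by (auto simp: le_def)

lemma le_integral: "C2 L y \<Longrightarrow> C2 L z \<Longrightarrow> le y z \<Longrightarrow> I y \<le> I z"
  by (intro integral_le integrable_continuous_real C2_derivatives(4)) (auto simp: le_def)

lemma W41_\<alpha>\<beta>: "W41 L \<alpha>" "W41 L \<beta>" "bc L \<alpha>" "bc L \<beta>"
  using lower upper by (auto simp: is_lower_def is_upper_def)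

lemma C2_\<alpha>\<beta>: "C2 L \<alpha>" "C2 L \<beta>"
  using W41_\<alpha>\<beta> by (auto intro: W41_C2)

lemma \<alpha>\<beta>_mem: "\<alpha> \<in> ord_int L \<alpha> \<beta>" "\<beta> \<in> ord_int L \<alpha> \<beta>" "le \<alpha> \<beta>"
  using C2_\<alpha>\<beta> \<alpha>\<beta> \<alpha>\<beta>2 by (auto simp: ord_int_def le_def)

lemma ord_int_boundary:
  assumes "u \<in> ord_int L \<alpha> \<beta>"
  shows "u 0 = 0" "u L = 0"
proof -
  have "0 \<in> {0..L}" "L \<in> {0..L}" using L by auto
  then show "u 0 = 0" "u L = 0"
    using assms W41_\<alpha>\<beta>(3,4) unfolding ord_int_def bc_def by force+
qed

text \<open>The hypotheses on \<open>M\<close> and \<open>N\<close> enter here, as signs of the two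
  coefficients that appear when \<open>rhs\<close> is compared at two ordered functions. The second
  uses that \<open>u''\<close> stays above the infimum of \<open>\<beta>''\<close>.\<close>

lemma ord_int_bounds:
  assumes "u \<in> ord_int L \<alpha> \<beta>"
  shows "a + b * I u \<le> M" "a + b * I \<alpha> \<le> a + b * I u"
    "x \<in> {0..L} \<Longrightarrow> D2 L u x \<le> 0" "x \<in> {0..L} \<Longrightarrow> 0 \<le> N - c + b * D2 L u x"
proof -
  have u: "C2 L u" "le \<alpha> u" "le u \<beta>" using assms by (auto simp: ord_int_le)
  have "b * I u \<le> b * I \<beta>" "b * I \<alpha> \<le> b * I u"
    using le_integral u C2_\<alpha>\<beta> b by (auto intro!: mult_left_mono)
  then show "a + b * I u \<le> M" "a + b * I \<alpha> \<le> a + b * I u" using M_bound by auto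
  show "D2 L u x \<le> 0" if "x \<in> {0..L}" using leD(2)[OF u(2) that] \<alpha>\<beta>2[OF that] by auto
  show "0 \<le> N - c + b * D2 L u x" if x: "x \<in> {0..L}"
  proof -
    have "bdd_below (D2 L \<beta> ` {0..L})"
      by (intro bounded_imp_bdd_below compact_imp_bounded compact_continuous_image
          C2_derivatives(3)[OF C2_\<alpha>\<beta>(2)]) auto
    then have "Inf (D2 L \<beta> ` {0..L}) \<le> D2 L \<beta> x" using x by (intro cInf_lower) auto
    also have "\<dots> \<le> D2 L u x" using leD(2)[OF u(3) x] .
    finally have "b * Inf (D2 L \<beta> ` {0..L}) \<le> b * D2 L u x" using b by simp
    then show ?thesis using N_bound by linarith
  qed
qed

lemma N_ge_c: "c \<le> N"
proof -
  have "0 \<in> {0..L}" using L by auto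
  then have "0 \<le> N - c + b * D2 L \<beta> 0" "b * D2 L \<beta> 0 \<le> 0"
    using ord_int_bounds(3,4)[OF \<alpha>\<beta>_mem(2)] b by (auto simp: mult_nonneg_nonpos)
  then show ?thesis by linarith
qed

lemma rhs_mono:
  assumes y: "y \<in> ord_int L \<alpha> \<beta>" and z: "z \<in> ord_int L \<alpha> \<beta>" and yz: "le y z" and x: "x \<in> {0..L}"
  shows "rhs y x \<le> rhs z x"
proof -
  have I: "0 \<le> I z - I y" using le_integral y z yz by (auto simp: ord_int_le)
  \<comment> \<open>The nonlinear product is split as
    \<open>I z * (z'' - y'') + (I z - I y) * y''\<close>, so that each ordered difference carries a
    coefficient of known sign.\<close>
  have "rhs z x - rhs y x = (M - (a + b * I z)) * (D2 L y x - D2 L z x)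
      + (I z - I y) * (N - c + b * D2 L y x)"
    by (simp add: rhs_def algebra_simps)
  also have "\<dots> \<ge> 0"
    using I ord_int_bounds(1)[OF z] ord_int_bounds(4)[OF y x] leD(2)[OF yz x]
    by (intro add_nonneg_nonneg[OF mult_nonneg_nonneg mult_nonneg_nonneg]) auto
  finally show ?thesis by simp
qed

lemma rhs_diff_le:
  assumes y: "y \<in> ord_int L \<alpha> \<beta>" and z: "z \<in> ord_int L \<alpha> \<beta>" and yz: "le y z" and x: "x \<in> {0..L}"
  shows "rhs z x - rhs y x \<le> (M - (a + b * I \<alpha>)) * (D2 L y x - D2 L z x) + (N - c) * (I z - I y)"
proof -
  have I: "0 \<le> I z - I y" using le_integral y z yz by (auto simp: ord_int_le)
  \<comment> \<open>Here the product is split the other way, with the integral frozen at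
    \<open>y\<close>. The term with \<open>z'' \<le> 0\<close> can then be dropped from an upper
    bound, and \<open>I y\<close> is replaced by \<open>I \<alpha>\<close>.\<close>
  have "rhs z x - rhs y x = (M - (a + b * I y)) * (D2 L y x - D2 L z x)
      + (N - c) * (I z - I y) + b * (I z - I y) * D2 L z x"
    by (simp add: rhs_def algebra_simps)
  moreover have "(M - (a + b * I y)) * (D2 L y x - D2 L z x) \<le> (M - (a + b * I \<alpha>)) * (D2 L y x - D2 L z x)"
    using ord_int_bounds(2)[OF y] leD(2)[OF yz x] by (intro mult_right_mono) auto
  moreover have "b * (I z - I y) * D2 L z x \<le> 0"
    using I b ord_int_bounds(3)[OF z x] by (intro mult_nonneg_nonpos) auto
  ultimately show ?thesis by linarith
qed

lemma comparison:
  assumes "W41 L u" "bc L u" "W41 L w" "bc L w"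
    "ae_on L (\<lambda>x. D4 L u x - M * D2 L u x + N * I u \<le> D4 L w x - M * D2 L w x + N * I w)"
  shows "le u w"
  unfolding le_def using linear_comparison[OF L M N assms] by blast

lemma step_mono:
  assumes y: "y \<in> ord_int L \<alpha> \<beta>" and z: "z \<in> ord_int L \<alpha> \<beta>" and yz: "le y z"
    and "step y y'" "step z z'"
  shows "le y' z'"
proof (rule comparison)
  show "ae_on L (\<lambda>x. D4 L y' x - M * D2 L y' x + N * I y' \<le> D4 L z' x - M * D2 L z' x + N * I z')"
    by (rule ae_on_mono2[of L "\<lambda>x. D4 L y' x - M * D2 L y' x + N * I y' = rhs y x"
          "\<lambda>x. D4 L z' x - M * D2 L z' x + N * I z' = rhs z x"])
      (use assms rhs_mono[OF y z yz] in \<open>auto simp: step_def\<close>)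
qed (use assms in \<open>auto simp: step_def\<close>)

text \<open>Rearranged, the inequality for a lower solution says that the linear operator at
  \<open>\<alpha>\<close> is at most \<open>rhs \<alpha>\<close>. This is at most
  \<open>rhs y\<close>, the linear operator at \<open>z\<close>, so comparison applies; the upper
  bound is symmetric.\<close>

lemma step_ord_int:
  assumes y: "y \<in> ord_int L \<alpha> \<beta>" and yz: "step y z"
  shows "z \<in> ord_int L \<alpha> \<beta>"
proof -
  have z: "W41 L z" "bc L z" "ae_on L (\<lambda>x. D4 L z x - M * D2 L z x + N * I z = rhs y x)"
    using yz by (auto simp: step_def)
  have y': "le \<alpha> y" "le y \<beta>" using y by (auto simp: ord_int_le)
  have "le \<alpha> z"
  proof (rule comparison[OF W41_\<alpha>\<beta>(1,3) z(1,2)])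
    have l: "ae_on L (\<lambda>x. Pop L a b c \<alpha> x \<le> p x)" using lower by (simp add: is_lower_def)
    show "ae_on L (\<lambda>x. D4 L \<alpha> x - M * D2 L \<alpha> x + N * I \<alpha> \<le> D4 L z x - M * D2 L z x + N * I z)"
    proof (rule ae_on_mono2[OF l z(3)])
      fix x assume "x \<in> {0..L}" "Pop L a b c \<alpha> x \<le> p x"
        and e: "D4 L z x - M * D2 L z x + N * I z = rhs y x"
      then have "D4 L \<alpha> x - M * D2 L \<alpha> x + N * I \<alpha> \<le> rhs \<alpha> x" "rhs \<alpha> x \<le> rhs y x"
        using rhs_mono[OF \<alpha>\<beta>_mem(1) y y'(1)] by (auto simp: Pop_def rhs_def)
      then show "D4 L \<alpha> x - M * D2 L \<alpha> x + N * I \<alpha> \<le> D4 L z x - M * D2 L z x + N * I z"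
        unfolding e by (rule order_trans)
    qed
  qed
  moreover have "le z \<beta>"
  proof (rule comparison[OF z(1,2) W41_\<alpha>\<beta>(2,4)])
    have l: "ae_on L (\<lambda>x. Pop L a b c \<beta> x \<ge> p x)" using upper by (simp add: is_upper_def)
    show "ae_on L (\<lambda>x. D4 L z x - M * D2 L z x + N * I z \<le> D4 L \<beta> x - M * D2 L \<beta> x + N * I \<beta>)"
    proof (rule ae_on_mono2[OF l z(3)])
      fix x assume "x \<in> {0..L}" "Pop L a b c \<beta> x \<ge> p x"
        and e: "D4 L z x - M * D2 L z x + N * I z = rhs y x"
      then have "rhs y x \<le> rhs \<beta> x" "rhs \<beta> x \<le> D4 L \<beta> x - M * D2 L \<beta> x + N * I \<beta>"
        using rhs_mono[OF y \<alpha>\<beta>_mem(2) y'(2)] by (auto simp: Pop_def rhs_def)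
      then show "D4 L z x - M * D2 L z x + N * I z \<le> D4 L \<beta> x - M * D2 L \<beta> x + N * I \<beta>"
        unfolding e by (rule order_trans)
    qed
  qed
  ultimately show ?thesis using W41_C2[OF z(1)] by (simp add: ord_int_le)
qed

lemma step_exists:
  assumes "C2 L y"
  shows "\<exists>z. step y z"
proof -
  have "rhs y absolutely_integrable_on {0..L}"
  proof -
    have "(\<lambda>x. (a + b * I y) * D2 L y x - c * I y - M * D2 L y x + N * I y) absolutely_integrable_on {0..L}"
      by (intro absolutely_integrable_continuous_real continuous_intros C2_derivatives(3)[OF assms])
    from set_integral_add(1)[OF p this] show ?thesis
      by (simp add: rhs_def[abs_def] algebra_simps)
  qed
  then show ?thesis
    using linear_solution_exists[OF L M less_imp_le[OF N(1)]] unfolding step_def by blast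
qed

lemma ord_int_diff_le:
  assumes y: "y \<in> ord_int L \<alpha> \<beta>" and z: "z \<in> ord_int L \<alpha> \<beta>" and C: "C \<ge> 0"
    and D: "\<And>x. x \<in> {0..L} \<Longrightarrow> D2 L y x - D2 L z x \<le> C" and x: "x \<in> {0..L}"
  shows "z x - y x \<le> C * (L^2 / 8)"
proof -
  have "z x - y x \<le> C * (x * (L - x) / 2)"
    using y z by (intro D2_diff_le_imp_diff_le[OF L _ _ _ _ _ _ D x] ord_int_boundary) (auto simp: ord_int_le)
  also have "\<dots> \<le> C * (L^2 / 8)" using C mult_diff_le_square by (intro mult_left_mono) auto
  finally show ?thesis .
qed

text \<open>The additional hypothesis makes one step contract the width \<open>max (y'' - z'')\<close>, because
  \<open>- u'' \<le> R\<close> and \<open>u(0) = u(L) = 0\<close> give \<open>u \<le> R L\<^sup>2 / 8\<close>.\<close>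

lemma step_contraction:
  assumes y: "y \<in> ord_int L \<alpha> \<beta>" and z: "z \<in> ord_int L \<alpha> \<beta>" and yz: "le y z"
    and y': "step y y'" and z': "step z z'" and C: "C \<ge> 0"
    and D: "\<And>x. x \<in> {0..L} \<Longrightarrow> D2 L y x - D2 L z x \<le> C" and x: "x \<in> {0..L}"
  shows "D2 L y' x - D2 L z' x \<le> C / 2"
proof -
  \<comment> \<open>A gap \<open>C\<close> between second derivatives gives a gap
    \<open>C * L^2 / 8\<close> between functions and \<open>C * L^3 / 8\<close> between integrals.
    Inserting the first and the last into \<open>rhs_diff_le\<close> produces
    \<open>R\<close>.\<close>
  define R where "R = C * ((M - (a + b * I \<alpha>)) + (N - c) * (L^3 / 8))"
  have Wy: "W41 L y'" "bc L y'" and Wz: "W41 L z'" "bc L z'" using y' z' by (auto simp: step_def)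
  have le': "le y' z'" by (rule step_mono[OF y z yz y' z'])
  have I': "I y' \<le> I z'" using le_integral Wy Wz W41_C2 le' by blast
  have C2yz: "C2 L y" "C2 L z" using y z by (auto simp: ord_int_le)
  have "I z - I y = integral {0..L} (\<lambda>x. z x - y x)"
    by (intro integral_diff[symmetric] integrable_continuous_real C2_derivatives(4) C2yz)
  also have "\<dots> \<le> integral {0..L} (\<lambda>x. C * (L^2 / 8))"
    using ord_int_diff_le[OF y z C D]
    by (intro integral_le integrable_continuous_real continuous_intros C2_derivatives(4) C2yz) auto
  also have "\<dots> = C * (L^3 / 8)" using L by (simp add: power2_eq_square power3_eq_cube)
  finally have Iyz: "I z - I y \<le> C * (L^3 / 8)" .
  have A: "0 \<le> M - (a + b * I \<alpha>)" using ord_int_bounds(1)[OF \<alpha>\<beta>_mem(1)] by simp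
  have rhs: "rhs z s - rhs y s \<le> R" if s: "s \<in> {0..L}" for s
  proof -
    have "(M - (a + b * I \<alpha>)) * (D2 L y s - D2 L z s) \<le> (M - (a + b * I \<alpha>)) * C"
      using A D[OF s] by (intro mult_left_mono) auto
    moreover have "(N - c) * (I z - I y) \<le> (N - c) * (C * (L^3 / 8))"
      using Iyz N_ge_c by (intro mult_left_mono) auto
    moreover have "R = (M - (a + b * I \<alpha>)) * C + (N - c) * (C * (L^3 / 8))"
      by (simp add: R_def algebra_simps)
    ultimately show ?thesis using rhs_diff_le[OF y z yz s] by linarith
  qed
  \<comment> \<open>Enlarging \<open>L^3 / 8\<close> to the \<open>L^3 / 4\<close> of the hypothesis
    gives \<open>R \<le> 4 * C / L^2\<close>; the height \<open>L^2 / 8\<close> of the parabola then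
    leaves the factor one half.\<close>
  have "R * (L^2 / 8) \<le> C / 2"
  proof -
    have "(M - (a + b * I \<alpha>)) + (N - c) * (L^3 / 8) \<le> (M - (a + b * I \<alpha>)) + (N - c) * (L^3 / 4)"
      using N_ge_c L by (intro add_left_mono mult_left_mono) auto
    also have "(N - c) * (L^3 / 4) = L^3 * N / 4 - L^3 / 4 * c"
      by (simp add: algebra_simps diff_divide_distrib)
    also have "M - (a + b * I \<alpha>) + (L^3 * N / 4 - L^3 / 4 * c) \<le> 4 / L^2" using contraction by linarith
    finally have "R \<le> C * (4 / L^2)" unfolding R_def using C by (intro mult_left_mono)
    then have "R * (L^2 / 8) \<le> C * (4 / L^2) * (L^2 / 8)" by (intro mult_right_mono) auto
    also have "\<dots> = C / 2" using L by (simp add: field_simps)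
    finally show ?thesis .
  qed
  moreover have "R \<ge> 0" unfolding R_def using C A N_ge_c L by (intro mult_nonneg_nonneg add_nonneg_nonneg) auto
  \<comment> \<open>With \<open>q = y''- z''\<close> for the new pair, \<open>q'' \<ge> - R\<close>
    almost everywhere: the terms with \<open>M\<close> and \<open>N\<close> have favourable signs
    because the new pair is again ordered. The parabola argument is repeated for \<open>q\<close>,
    whose first derivative is only absolutely continuous.\<close>
  moreover have "0 \<le> R * (x * (L - x) / 2) - (D2 L y' x - D2 L z' x)"
  proof -
    note dy = W41_derivatives[OF L Wy(1)] and dz = W41_derivatives[OF L Wz(1)]
    obtain Z1 where Z1: "negligible Z1"
      "\<And>x. x \<in> {0..L} - Z1 \<Longrightarrow> D4 L y' x - M * D2 L y' x + N * I y' = rhs y x"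
      using y' unfolding step_def ae_on_def by blast
    obtain Z2 where Z2: "negligible Z2"
      "\<And>x. x \<in> {0..L} - Z2 \<Longrightarrow> D4 L z' x - M * D2 L z' x + N * I z' = rhs z x"
      using z' unfolding step_def ae_on_def by blast
    have q: "primitive_on 0 L (\<lambda>x. R * ((L - 2 * x) / 2)) (\<lambda>x. - R)"
      by (rule primitive_on_C1) (auto intro!: derivative_eq_intros continuous_intros)
    show ?thesis
    proof (rule concave_nonneg[OF x L, where f = "\<lambda>x. - R - (D4 L y' x - D4 L z' x)" and Z = "Z1 \<union> Z2"
          and ?v1.0 = "\<lambda>x. R * ((L - 2 * x) / 2) - (der L (D2 L y') x - der L (D2 L z') x)"])
      show "primitive_on 0 L (\<lambda>x. R * ((L - 2 * x) / 2) - (der L (D2 L y') x - der L (D2 L z') x))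
          (\<lambda>x. - R - (D4 L y' x - D4 L z' x))"
        using primitive_on_lincomb[OF q primitive_on_lincomb[OF dy(2) dz(2), of 1 "-1"], of 1 "-1"]
        by (simp add: algebra_simps)
      show "negligible (Z1 \<union> Z2)" using Z1 Z2 by simp
      fix s assume s: "s \<in> {0..L} - (Z1 \<union> Z2)"
      have "M * (D2 L z' s - D2 L y' s) \<le> 0" using leD(2)[OF le', of s] s M by (simp add: mult_nonneg_nonpos)
      moreover have "N * I y' \<le> N * I z'" using I' N by simp
      moreover have "D4 L y' s - M * D2 L y' s + N * I y' = rhs y s" using Z1(2) s by auto
      moreover have "D4 L z' s - M * D2 L z' s + N * I z' = rhs z s" using Z2(2) s by auto
      ultimately show "- R - (D4 L y' s - D4 L z' s) \<le> 0"
        using rhs[of s] s by (simp add: algebra_simps)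
    next
      fix s assume "s \<in> {0..L}"
      then show "((\<lambda>x. R * (x * (L - x) / 2) - (D2 L y' x - D2 L z' x)) has_real_derivative
          R * ((L - 2 * s) / 2) - (der L (D2 L y') s - der L (D2 L z') s)) (at s within {0..L})"
        using dy(1) dz(1) by (auto intro!: derivative_eq_intros simp: field_simps)
    qed (use Wy Wz in \<open>auto simp: bc_def\<close>)
  qed
  moreover have "R * (x * (L - x) / 2) \<le> R * (L^2 / 8)"
    using \<open>R \<ge> 0\<close> mult_diff_le_square by (intro mult_left_mono) auto
  ultimately show ?thesis by linarith
qed

section \<open>The extremal iterations and their common limit\<close>

text \<open>A successor has to be chosen, since \<open>step\<close> leaves its values outside
  \<open>{0..L}\<close> open.\<close>

definition next_iter :: "(real \<Rightarrow> real) \<Rightarrow> real \<Rightarrow> real" where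
  "next_iter y = (SOME z. step y z)"

lemma step_next_iter: "y \<in> ord_int L \<alpha> \<beta> \<Longrightarrow> step y (next_iter y)"
  unfolding next_iter_def by (rule someI_ex[OF step_exists]) (simp add: ord_int_le)

definition lo :: "nat \<Rightarrow> real \<Rightarrow> real" where "lo n = (next_iter ^^ n) \<alpha>"
definition hi :: "nat \<Rightarrow> real \<Rightarrow> real" where "hi n = (next_iter ^^ n) \<beta>"

lemma iterates_ord_int: "y \<in> ord_int L \<alpha> \<beta> \<Longrightarrow> (next_iter ^^ n) y \<in> ord_int L \<alpha> \<beta>"
proof (induction n)
  case (Suc n)
  then show ?case using step_ord_int[OF _ step_next_iter] by simp
qed simp

lemma lo_hi_mem: "lo n \<in> ord_int L \<alpha> \<beta>" "hi n \<in> ord_int L \<alpha> \<beta>"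
  unfolding lo_def hi_def by (auto intro: iterates_ord_int \<alpha>\<beta>_mem)

lemma lo_hi_step: "step (lo n) (lo (Suc n))" "step (hi n) (hi (Suc n))"
  using step_next_iter[OF lo_hi_mem(1)] step_next_iter[OF lo_hi_mem(2)] by (simp_all add: lo_def hi_def)

lemma lo_hi_0: "lo 0 = \<alpha>" "hi 0 = \<beta>"
  by (simp_all add: lo_def hi_def)

lemma squeeze:
  assumes "\<And>n. y n \<in> ord_int L \<alpha> \<beta>" "\<And>n. step (y n) (y (Suc n))"
  shows "le (lo n) (y n)" "le (y n) (hi n)"
proof -
  show "le (lo n) (y n)"
  proof (induction n)
    case 0
    then show ?case using assms(1)[of 0] by (simp add: lo_hi_0 ord_int_le)
  next
    case (Suc n)
    then show ?case by (rule step_mono[OF lo_hi_mem(1) assms(1) _ lo_hi_step(1) assms(2)])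
  qed
  show "le (y n) (hi n)"
  proof (induction n)
    case 0
    then show ?case using assms(1)[of 0] by (simp add: lo_hi_0 ord_int_le)
  next
    case (Suc n)
    then show ?case by (rule step_mono[OF assms(1) lo_hi_mem(2) _ assms(2) lo_hi_step(2)])
  qed
qed

text \<open>The shifted sequence is itself an iteration inside the order interval, so the squeeze
  applied to it is the monotonicity of \<open>lo\<close>.\<close>

lemma lo_Suc: "le (lo n) (lo (Suc n))"
  by (rule squeeze(1)[of "\<lambda>n. lo (Suc n)", OF lo_hi_mem(1) lo_hi_step(1)])

lemma hi_Suc: "le (hi (Suc n)) (hi n)"
  by (rule squeeze(2)[of "\<lambda>n. hi (Suc n)", OF lo_hi_mem(2) lo_hi_step(2)])

lemma lo_mono: "n \<le> k \<Longrightarrow> le (lo n) (lo k)"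
proof (induction rule: dec_induct)
  case base
  show ?case by (rule le_refl)
next
  case (step k)
  show ?case by (rule le_trans[OF step.IH lo_Suc])
qed

lemma hi_mono: "n \<le> k \<Longrightarrow> le (hi k) (hi n)"
proof (induction rule: dec_induct)
  case base
  show ?case by (rule le_refl)
next
  case (step k)
  show ?case by (rule le_trans[OF hi_Suc step.IH])
qed

lemma lo_le_hi: "le (lo n) (hi k)"
proof -
  have "le (lo n) (lo (max n k))" by (simp add: lo_mono)
  moreover have "le (lo (max n k)) (hi (max n k))" by (rule squeeze(2)[of lo, OF lo_hi_mem(1) lo_hi_step(1)])
  moreover have "le (hi (max n k)) (hi k)" by (simp add: hi_mono)
  ultimately show ?thesis using le_trans by blast
qed

lemma width:
  obtains C where "C \<ge> 0"
    "\<And>n x. x \<in> {0..L} \<Longrightarrow> D2 L (lo n) x - D2 L (hi n) x \<le> C / 2 ^ n"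
    "\<And>n x. x \<in> {0..L} \<Longrightarrow> hi n x - lo n x \<le> C / 2 ^ n * (L\<^sup>2 / 8)"
proof -
  have "continuous_on {0..L} (\<lambda>x. D2 L \<alpha> x - D2 L \<beta> x)"
    using C2_derivatives(3)[OF C2_\<alpha>\<beta>(1)] C2_derivatives(3)[OF C2_\<alpha>\<beta>(2)] by (rule continuous_on_diff)
  then have "bounded ((\<lambda>x. D2 L \<alpha> x - D2 L \<beta> x) ` {0..L})"
    by (intro compact_imp_bounded compact_continuous_image) auto
  then obtain C where C: "C > 0" "\<And>x. x \<in> {0..L} \<Longrightarrow> \<bar>D2 L \<alpha> x - D2 L \<beta> x\<bar> \<le> C"
    unfolding bounded_pos by auto
  have w: "\<forall>x\<in>{0..L}. D2 L (lo n) x - D2 L (hi n) x \<le> C / 2 ^ n" for n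
  proof (induction n)
    case 0
    then show ?case using C(2) by (force simp: lo_hi_0)
  next
    case (Suc n)
    show ?case
    proof
      fix x assume x: "x \<in> {0..L}"
      have "D2 L (lo (Suc n)) x - D2 L (hi (Suc n)) x \<le> (C / 2 ^ n) / 2"
        using Suc C(1) by (intro step_contraction[OF lo_hi_mem lo_le_hi lo_hi_step _ _ x]) auto
      then show "D2 L (lo (Suc n)) x - D2 L (hi (Suc n)) x \<le> C / 2 ^ Suc n" by simp
    qed
  qed
  have "hi n x - lo n x \<le> C / 2 ^ n * (L\<^sup>2 / 8)" if "x \<in> {0..L}" for n x
    using w C(1) by (intro ord_int_diff_le[OF lo_hi_mem _ _ that]) auto
  then show ?thesis using that[of C] C(1) w by auto
qed

text \<open>The limit is built from second derivatives: they decrease along \<open>lo\<close>,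
  converge uniformly because the width tends to 0, and their continuous limit \<open>V\<close> is
  integrated twice with zero boundary values. The order against \<open>lo n\<close> and
  \<open>hi n\<close> is recovered from that of the second derivatives.\<close>

lemma limit_exists:
  obtains u where "u \<in> ord_int L \<alpha> \<beta>" "\<And>n. le (lo n) u" "\<And>n. le u (hi n)"
proof -
  obtain C where C: "C \<ge> 0" "\<And>n x. x \<in> {0..L} \<Longrightarrow> D2 L (lo n) x - D2 L (hi n) x \<le> C / 2 ^ n"
    "\<And>n x. x \<in> {0..L} \<Longrightarrow> hi n x - lo n x \<le> C / 2 ^ n * (L\<^sup>2 / 8)"
    using width by blast
  define V where "V x = (INF n. D2 L (lo n) x)" for x
  have V_le: "V x \<le> D2 L (lo n) x" if "x \<in> {0..L}" for x n
    unfolding V_def using leD(2)[OF lo_le_hi[of _ 0] that]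
    by (intro cINF_lower bdd_belowI2[of _ "D2 L (hi 0) x"]) auto
  have V_ge: "D2 L (hi n) x \<le> V x" if "x \<in> {0..L}" for x n
    unfolding V_def using leD(2)[OF lo_le_hi that] by (intro cINF_greatest) auto
  have lim: "uniform_limit {0..L} (\<lambda>n. D2 L (lo n)) V sequentially"
  proof (rule uniform_limitI)
    fix e :: real assume "e > 0"
    have "(\<lambda>n. C / 2 ^ n) \<longlonglongrightarrow> 0" by (rule LIMSEQ_divide_realpow_zero) simp
    then have "\<forall>\<^sub>F n in sequentially. C / 2 ^ n < e" using \<open>e > 0\<close> by (rule order_tendstoD)
    then show "\<forall>\<^sub>F n in sequentially. \<forall>x\<in>{0..L}. dist (D2 L (lo n) x) (V x) < e"
    proof eventually_elim
      case (elim n)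
      show ?case
      proof
        fix x assume x: "x \<in> {0..L}"
        show "dist (D2 L (lo n) x) (V x) < e"
          using V_le[OF x, of n] V_ge[OF x, of n] C(2)[OF x, of n] elim by (simp add: dist_real_def)
      qed
    qed
  qed
  have C2: "C2 L (lo n)" "C2 L (hi n)" for n using lo_hi_mem by (auto simp: ord_int_le)
  have Vc: "continuous_on {0..L} V"
    using lim by (rule uniform_limit_theorem[rotated]) (simp_all add: C2_derivatives(3)[OF C2(1)])
  obtain u u1 where du: "\<And>x. x \<in> {0..L} \<Longrightarrow> (u has_real_derivative u1 x) (at x within {0..L})"
    "\<And>x. x \<in> {0..L} \<Longrightarrow> (u1 has_real_derivative V x) (at x within {0..L})"
    and bd: "u 0 = 0" "u L = 0"
    using second_primitive[OF L Vc] by blast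
  have u: "C2 L u" "\<And>x. x \<in> {0..L} \<Longrightarrow> D2 L u x = V x"
    using C2_I[OF L du Vc] by blast+
  have lo: "le (lo n) u" for n
    unfolding le_def
  proof
    fix x assume x: "x \<in> {0..L}"
    have "lo n x - u x \<le> 0 * (x * (L - x) / 2)"
      by (rule D2_diff_le_imp_diff_le[OF L u(1) bd C2(1) ord_int_boundary[OF lo_hi_mem(1)] _ x])
        (use u(2) V_le in auto)
    then show "lo n x \<le> u x \<and> D2 L u x \<le> D2 L (lo n) x" using u(2)[OF x] V_le[OF x] by simp
  qed
  have hi: "le u (hi n)" for n
    unfolding le_def
  proof
    fix x assume x: "x \<in> {0..L}"
    have "u x - hi n x \<le> 0 * (x * (L - x) / 2)"
      by (rule D2_diff_le_imp_diff_le[OF L C2(2) ord_int_boundary[OF lo_hi_mem(2)] u(1) bd _ x])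
        (use u(2) V_ge in auto)
    then show "u x \<le> hi n x \<and> D2 L (hi n) x \<le> D2 L u x" using u(2)[OF x] V_ge[OF x] by simp
  qed
  show ?thesis
    using that[OF _ lo hi] u(1) lo[of 0] hi[of 0] by (simp add: ord_int_le lo_hi_0)
qed

text \<open>\<open>yt\<close> is one step applied to the C2 limit \<open>u\<close>, so it lies in
  W41. Both are trapped between \<open>lo (Suc n)\<close> and \<open>hi (Suc n)\<close> for every
  \<open>n\<close>, hence they agree on the interval together with their second derivatives, and the
  auxiliary linear terms of the step equation cancel.\<close>

lemma solution_exists:
  obtains yt where "yt \<in> ord_int L \<alpha> \<beta>" "is_sol L a b c p yt" "\<And>n. le (lo n) yt" "\<And>n. le yt (hi n)"
proof -
  obtain C where C: "C \<ge> 0" "\<And>n x. x \<in> {0..L} \<Longrightarrow> D2 L (lo n) x - D2 L (hi n) x \<le> C / 2 ^ n"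
    "\<And>n x. x \<in> {0..L} \<Longrightarrow> hi n x - lo n x \<le> C / 2 ^ n * (L\<^sup>2 / 8)"
    using width by blast
  obtain u where u: "u \<in> ord_int L \<alpha> \<beta>" "\<And>n. le (lo n) u" "\<And>n. le u (hi n)"
    using limit_exists by blast
  define yt where "yt = next_iter u"
  have st: "step u yt" unfolding yt_def by (rule step_next_iter[OF u(1)])
  have mem: "yt \<in> ord_int L \<alpha> \<beta>" by (rule step_ord_int[OF u(1) st])
  have lo: "le (lo (Suc n)) yt" and hi: "le yt (hi (Suc n))" for n
    using step_mono[OF lo_hi_mem(1) u(1) u(2) lo_hi_step(1) st]
      step_mono[OF u(1) lo_hi_mem(2) u(3) st lo_hi_step(2)] by auto
  have zero: "d = 0" if "\<And>n. \<bar>d\<bar> \<le> C / 2 ^ Suc n * K" for d K :: real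
  proof -
    have "(\<lambda>n. C / 2 ^ Suc n * K) \<longlonglongrightarrow> 0"
      by (intro tendsto_mult_left_zero LIMSEQ_Suc LIMSEQ_divide_realpow_zero) simp
    then have "\<bar>d\<bar> \<le> 0" by (rule LIMSEQ_le_const) (use that in auto)
    then show ?thesis by simp
  qed
  have D2eq: "D2 L yt x = D2 L u x" if x: "x \<in> {0..L}" for x
  proof -
    have "\<bar>D2 L yt x - D2 L u x\<bar> \<le> C / 2 ^ Suc n * 1" for n
      using C(2)[OF x, of "Suc n"] leD(2)[OF lo[of n] x] leD(2)[OF hi[of n] x]
        leD(2)[OF u(2)[of "Suc n"] x] leD(2)[OF u(3)[of "Suc n"] x] by linarith
    from zero[OF this] show ?thesis by simp
  qed
  have eq: "yt x = u x" if x: "x \<in> {0..L}" for x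
  proof -
    have "\<bar>yt x - u x\<bar> \<le> C / 2 ^ Suc n * (L\<^sup>2 / 8)" for n
      using C(3)[OF x, of "Suc n"] leD(1)[OF lo[of n] x] leD(1)[OF hi[of n] x]
        leD(1)[OF u(2)[of "Suc n"] x] leD(1)[OF u(3)[of "Suc n"] x] by linarith
    from zero[OF this] show ?thesis by simp
  qed
  have I_eq: "I u = I yt" by (rule integral_cong) (simp add: eq)
  have "ae_on L (\<lambda>x. Pop L a b c yt x = p x)"
  proof (rule ae_on_mono)
    show "ae_on L (\<lambda>x. D4 L yt x - M * D2 L yt x + N * I yt = rhs u x)" using st by (simp add: step_def)
    fix x assume "x \<in> {0..L}" "D4 L yt x - M * D2 L yt x + N * I yt = rhs u x"
    then show "Pop L a b c yt x = p x" by (simp add: Pop_def rhs_def I_eq D2eq algebra_simps)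
  qed
  then have "is_sol L a b c p yt" using st by (simp add: is_sol_def step_def)
  moreover have "le (lo n) yt" "le yt (hi n)" for n
    using u(2)[of n] u(3)[of n] by (auto simp: le_def eq D2eq)
  ultimately show ?thesis using that mem by blast
qed

lemma iteration_converges:
  assumes yt: "\<And>n. le (lo n) yt" "\<And>n. le yt (hi n)"
    and y0: "y0 \<in> ord_int L \<alpha> \<beta>" and y: "iter_seq L a b c p M N y0 y"
  shows "uniform_limit {0..L} y yt sequentially"
proof (rule uniform_limitI)
  fix e :: real assume "e > 0"
  obtain C where C: "C \<ge> 0" "\<And>n x. x \<in> {0..L} \<Longrightarrow> D2 L (lo n) x - D2 L (hi n) x \<le> C / 2 ^ n"
    "\<And>n x. x \<in> {0..L} \<Longrightarrow> hi n x - lo n x \<le> C / 2 ^ n * (L\<^sup>2 / 8)"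
    using width by blast
  have st: "step (y n) (y (Suc n))" and 0: "y 0 = y0" for n using y by (auto simp: iter_seq_step)
  have mem: "y n \<in> ord_int L \<alpha> \<beta>" for n
    by (induction n) (simp_all add: y0 0 step_ord_int[OF _ st])
  have "(\<lambda>n. C / 2 ^ n * (L\<^sup>2 / 8)) \<longlonglongrightarrow> 0"
    by (intro tendsto_mult_left_zero LIMSEQ_divide_realpow_zero) simp
  then have "\<forall>\<^sub>F n in sequentially. C / 2 ^ n * (L\<^sup>2 / 8) < e" using \<open>e > 0\<close> by (rule order_tendstoD)
  then show "\<forall>\<^sub>F n in sequentially. \<forall>x\<in>{0..L}. dist (y n x) (yt x) < e"
  proof eventually_elim
    case (elim n)
    show ?case
    proof
      fix x assume x: "x \<in> {0..L}"
      show "dist (y n x) (yt x) < e"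
        using leD(1)[OF squeeze(1)[of y, OF mem st] x, of n] leD(1)[OF squeeze(2)[of y, OF mem st] x, of n]
          leD(1)[OF yt(1)[of n] x] leD(1)[OF yt(2)[of n] x] C(3)[OF x, of n] elim
        by (simp add: dist_real_def)
    qed
  qed
qed

lemma iteration_exists: "y0 \<in> ord_int L \<alpha> \<beta> \<Longrightarrow> \<exists>y. iter_seq L a b c p M N y0 y"
  by (rule exI[of _ "\<lambda>n. (next_iter ^^ n) y0"])
    (simp add: iter_seq_step step_next_iter iterates_ord_int)

lemma solution_iter_seq:
  assumes "is_sol L a b c p z"
  shows "iter_seq L a b c p M N z (\<lambda>n. z)"
proof -
  have z: "W41 L z" "bc L z" "ae_on L (\<lambda>x. Pop L a b c z x = p x)"
    using assms by (auto simp: is_sol_def)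
  have "ae_on L (\<lambda>x. D4 L z x - M * D2 L z x + N * I z = rhs z x)"
    using z(3) by (rule ae_on_mono) (auto simp: Pop_def rhs_def)
  then show ?thesis using z by (simp add: iter_seq_step step_def)
qed

end

theorem theorem4p2:
  fixes L a b c M N :: real and p \<alpha> \<beta> :: "real \<Rightarrow> real"
  assumes "L > 0" "a > 0" "b > 0" "c > 0"
    and "p absolutely_integrable_on {0..L}"
    and "M > 0" "N > 0" "N \<le> 4 * M / L ^ 3 * sigma (sqrt M * L)"
    and "is_lower L a b c p \<alpha>" "is_upper L a b c p \<beta>"
    and "\<forall>x\<in>{0..L}. 0 \<le> \<alpha> x \<and> \<alpha> x \<le> \<beta> x"
    and "\<forall>x\<in>{0..L}. 0 \<ge> D2 L \<alpha> x \<and> D2 L \<alpha> x \<ge> D2 L \<beta> x"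
    and "a + b * integral {0..L} \<beta> \<le> M"
    and "c - b * Inf (D2 L \<beta> ` {0..L}) \<le> N"
    and "a + b * integral {0..L} \<alpha> + L ^ 3 / 4 * c > L ^ 3 * N / 4 + M - 4 / L ^ 2"
  shows "\<exists>yt. yt \<in> ord_int L \<alpha> \<beta> \<and> is_sol L a b c p yt \<and>
     (\<forall>z\<in>ord_int L \<alpha> \<beta>. is_sol L a b c p z \<longrightarrow> (\<forall>x\<in>{0..L}. z x = yt x)) \<and>
     (\<forall>y. iter_seq L a b c p M N \<alpha> y \<longrightarrow> uniform_limit {0..L} y yt sequentially) \<and>
     (\<forall>y. iter_seq L a b c p M N \<beta> y \<longrightarrow> uniform_limit {0..L} y yt sequentially) \<and>
     (\<forall>y0\<in>ord_int L \<alpha> \<beta>. (\<exists>y. iter_seq L a b c p M N y0 y) \<and>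
        (\<forall>y. iter_seq L a b c p M N y0 y \<longrightarrow> uniform_limit {0..L} y yt sequentially))"
proof -
  interpret beam_problem L a b c M N p \<alpha> \<beta>
    by unfold_locales (use assms in auto)
  obtain yt where yt: "yt \<in> ord_int L \<alpha> \<beta>" "is_sol L a b c p yt" "\<And>n. le (lo n) yt" "\<And>n. le yt (hi n)"
    using solution_exists by blast
  note conv = iteration_converges[OF yt(3,4)]
  have "z x = yt x" if z: "z \<in> ord_int L \<alpha> \<beta>" "is_sol L a b c p z" and x: "x \<in> {0..L}" for z x
  proof -
    have "uniform_limit {0..L} (\<lambda>n. z) yt sequentially"
      by (rule conv[OF z(1) solution_iter_seq[OF z(2)]])
    then have "(\<lambda>n::nat. z x) \<longlonglongrightarrow> yt x" using x by (rule tendsto_uniform_limitI)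
    then show ?thesis by (simp add: LIMSEQ_const_iff)
  qed
  then show ?thesis
    using yt(1,2) conv iteration_exists \<alpha>\<beta>_mem(1,2) by blast
qed

end
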